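(* Let $X$ be a compact Hausdorff space and let $E$, $F$ be Banach spaces. Every continuous linear operator $T\colon C(X,E)\to F^*$ is uniquely extendable to a linear operator $\bar{T}\colon M(X,E)\to F^*$ with the following property: whenever $f_n\in M(X,E)$ are uniformly bounded and converge pointwise to $f\in M(X,E)$ in the weak topology of $E$, then $\bar{T}f_n$ converge to $\bar{T}f$ in the weak* topology of $F^*$. Moreover, $\bar{T}$ is continuous and $\|\bar{T}\|=\|T\|$.
   Context: Banach spaces are over a fixed field $\mathbb{K}$ of real or complex numbers. $C(X,E)$ is the space of continuous functions $X\to E$ with the sup-norm. $\mathfrak{M}(X)$ is the smallest $\sigma$-algebra on $X$ containing all closed subsets of $X$ of type $\mathcal{G}_\delta$. $M(X,E)$ is the space, with the sup-norm, of all bounded functions $f\colon X\to E$ such that $f(X)$ is a separable subspace of $E$ and $\psi\circ f\colon X\to\mathbb{K}$ is $\mathfrak{M}(X)$-measurable for every $\psi\in E^*$. *)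

theory Defs
  imports "HOL-Analysis.Analysis"
begin

text \<open>
  The scalar field: a normed field that is isometrically isomorphic to the reals or to the
  complex numbers.
\<close>

class real_or_complex = real_normed_field +
  assumes real_or_complex_iso:
    "\<exists>h :: 'a \<Rightarrow> complex.
       (\<forall>x y. h (x + y) = h x + h y) \<and> (\<forall>x y. h (x * y) = h x * h y) \<and>
       (\<forall>x. norm (h x) = norm x) \<and> (range h = \<real> \<or> range h = UNIV)"

instance real :: real_or_complex
  by standard (rule exI[of _ complex_of_real], auto simp: Reals_def)

instance complex :: real_or_complex
  by standard (rule exI[of _ id], auto)

text \<open>
  Normed spaces over \<open>'k\<close>.  The type class supplies the norm and the underlying real vector space;
  the explicit scalar multiplication by \<open>'k\<close> extends the one by the reals.  A Banach space
  over \<open>'k\<close> is the case where the carrier type is of class \<open>banach\<close>.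
\<close>

locale normed_space_over = vector_space sm
  for sm :: "'k::real_or_complex \<Rightarrow> 'e::real_normed_vector \<Rightarrow> 'e" +
  assumes scale_of_real: "sm (of_real r) x = r *\<^sub>R x"
    and norm_scale: "norm (sm c x) = norm c * norm x"

text \<open>
  Elements of \<open>'e \<Rightarrow>\<^sub>L 'k\<close> are only real-linear, so the dual is cut out by homogeneity
  over \<open>'k\<close>.
\<close>

definition dual_space ::
    "('k::real_or_complex \<Rightarrow> 'e::real_normed_vector \<Rightarrow> 'e) \<Rightarrow> ('e \<Rightarrow>\<^sub>L 'k) set" where
  "dual_space sm = {\<psi>. \<forall>c x. blinfun_apply \<psi> (sm c x) = c * blinfun_apply \<psi> x}"

definition dual_scale ::
    "'k::real_or_complex \<Rightarrow> ('e::real_normed_vector \<Rightarrow>\<^sub>L 'k) \<Rightarrow> ('e \<Rightarrow>\<^sub>L 'k)" where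
  "dual_scale c \<psi> = blinfun_mult_right c o\<^sub>L \<psi>"

definition weak_topology ::
    "('k::real_or_complex \<Rightarrow> 'e::real_normed_vector \<Rightarrow> 'e) \<Rightarrow> 'e topology" where
  "weak_topology sm =
     topology_generated_by {blinfun_apply \<psi> -` U |\<psi> U. \<psi> \<in> dual_space sm \<and> open U}"

definition weak_star_topology ::
    "('k::real_or_complex \<Rightarrow> 'f::real_normed_vector \<Rightarrow> 'f) \<Rightarrow> ('f \<Rightarrow>\<^sub>L 'k) topology" where
  "weak_star_topology sm =
     topology_generated_by {{\<phi> \<in> dual_space sm. blinfun_apply \<phi> y \<in> U} |y U. open U}"

text \<open>
  For compact \<open>'x\<close> the type \<open>'x \<Rightarrow>\<^sub>C 'e\<close> of bounded continuous functions is $C(X,E)$ with the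
  sup-norm.
\<close>

definition bcontfun_scale ::
    "('k::real_or_complex \<Rightarrow> 'e::real_normed_vector \<Rightarrow> 'e) \<Rightarrow> 'k \<Rightarrow>
     ('x::topological_space \<Rightarrow>\<^sub>C 'e) \<Rightarrow> ('x \<Rightarrow>\<^sub>C 'e)" where
  "bcontfun_scale sm c f = Bcontfun (\<lambda>x. sm c (apply_bcontfun f x))"

lemma (in normed_space_over) bounded_linear_scale: "bounded_linear (sm c)"
proof (rule bounded_linear_intro[where K = "norm c"])
  fix x y :: 'e and r :: real
  show "sm c (x + y) = sm c x + sm c y" by (rule scale_right_distrib)
  show "sm c (r *\<^sub>R x) = r *\<^sub>R sm c x"
    by (simp flip: scale_of_real add: mult.commute)
  show "norm (sm c x) \<le> norm x * norm c" by (simp add: norm_scale)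
qed

lemma (in normed_space_over) apply_bcontfun_scale:
  "apply_bcontfun (bcontfun_scale sm c f) x = sm c (apply_bcontfun f x)"
proof -
  have "(\<lambda>x. sm c (apply_bcontfun f x)) \<in> bcontfun"
    unfolding bcontfun_def
    using bounded_linear.continuous_on[OF bounded_linear_scale continuous_on_apply_bcontfun]
      bounded_linear_image[OF bounded_apply_bcontfun bounded_linear_scale]
    by (auto simp: image_image)
  then show ?thesis by (simp add: bcontfun_scale_def Bcontfun_inverse)
qed

definition baire_algebra :: "'x::topological_space measure" where
  "baire_algebra = sigma UNIV {A. closed A \<and> gdelta A}"

definition M_space ::
    "('k::real_or_complex \<Rightarrow> 'e::real_normed_vector \<Rightarrow> 'e) \<Rightarrow> ('x::topological_space \<Rightarrow> 'e) set" where
  "M_space sm =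
     {f. bounded (range f) \<and> separable_space (top_of_set (range f)) \<and>
         (\<forall>\<psi>\<in>dual_space sm. (\<lambda>x. blinfun_apply \<psi> (f x)) \<in> measurable baire_algebra borel)}"

definition sup_norm :: "('x \<Rightarrow> 'e::real_normed_vector) \<Rightarrow> real" where
  "sup_norm f = (SUP x. norm (f x))"

definition M_topology ::
    "('k::real_or_complex \<Rightarrow> 'e::real_normed_vector \<Rightarrow> 'e) \<Rightarrow>
     ('x::topological_space \<Rightarrow> 'e) topology" where
  "M_topology sm = Metric_space.mtopology (M_space sm) (Met_TC.fdist UNIV)"

text \<open>The metric used here is the one induced by the sup-norm.\<close>

lemma fdist_eq_sup_norm:
  assumes "f \<in> M_space sm" "g \<in> M_space sm"
  shows "Met_TC.fdist UNIV f g = sup_norm (\<lambda>x. f x - g x)"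
  using assms
  by (simp add: Met_TC.fdist_def Met_TC.fspace_def M_space_def sup_norm_def dist_norm)

lemma Metric_space_M_space: "Metric_space (M_space sm) (Met_TC.fdist UNIV)"
proof (rule Metric_space.subspace)
  show "Metric_space (Met_TC.fspace UNIV) (Met_TC.fdist UNIV)"
    by (rule Met_TC.Metric_space_funspace)
  show "M_space sm \<subseteq> Met_TC.fspace UNIV"
    by (auto simp: Met_TC.fspace_def M_space_def)
qed

text \<open>The analogue of \<^const>\<open>onorm\<close> for operators defined on $M(X,E)$.\<close>

definition M_onorm ::
    "('k::real_or_complex \<Rightarrow> 'e::real_normed_vector \<Rightarrow> 'e) \<Rightarrow>
     (('x::topological_space \<Rightarrow> 'e) \<Rightarrow> 'g::real_normed_vector) \<Rightarrow> real" where
  "M_onorm sm S = (SUP f\<in>M_space sm. norm (S f) / sup_norm f)"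

text \<open>
  Operators on $M(X,E)$ are total functions on \<open>'x \<Rightarrow> 'e\<close> whose values outside
  \<^const>\<open>M_space\<close> are irrelevant.
\<close>

definition M_linear ::
    "('k::real_or_complex \<Rightarrow> 'e::real_normed_vector \<Rightarrow> 'e) \<Rightarrow>
     ('k \<Rightarrow> 'f::real_normed_vector \<Rightarrow> 'f) \<Rightarrow>
     (('x::topological_space \<Rightarrow> 'e) \<Rightarrow> ('f \<Rightarrow>\<^sub>L 'k)) \<Rightarrow> bool" where
  "M_linear scaleE scaleF S \<longleftrightarrow>
     S \<in> M_space scaleE \<rightarrow> dual_space scaleF \<and>
     (\<forall>f\<in>M_space scaleE. \<forall>g\<in>M_space scaleE. S (\<lambda>x. f x + g x) = S f + S g) \<and>
     (\<forall>c. \<forall>f\<in>M_space scaleE. S (\<lambda>x. scaleE c (f x)) = dual_scale c (S f))"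

definition weak_sequential_extension ::
    "('k::real_or_complex \<Rightarrow> 'e::real_normed_vector \<Rightarrow> 'e) \<Rightarrow>
     ('k \<Rightarrow> 'f::real_normed_vector \<Rightarrow> 'f) \<Rightarrow>
     (('x::topological_space \<Rightarrow>\<^sub>C 'e) \<Rightarrow> ('f \<Rightarrow>\<^sub>L 'k)) \<Rightarrow>
     (('x \<Rightarrow> 'e) \<Rightarrow> ('f \<Rightarrow>\<^sub>L 'k)) \<Rightarrow> bool" where
  "weak_sequential_extension scaleE scaleF T S \<longleftrightarrow>
     M_linear scaleE scaleF S \<and>
     (\<forall>f. S (apply_bcontfun f) = T f) \<and>
     (\<forall>f g. (\<forall>n. f n \<in> M_space scaleE) \<and> g \<in> M_space scaleE \<and>
        (\<exists>B. \<forall>n x. norm (f n x) \<le> B) \<and>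
        (\<forall>x. limitin (weak_topology scaleE) (\<lambda>n. f n x) (g x) sequentially) \<longrightarrow>
        limitin (weak_star_topology scaleF) (\<lambda>n. S (f n)) (S g) sequentially)"

end

theory Submission
  imports Defs "HOL-Library.Function_Algebras"
begin

text \<open>
  Composing with \<open>g \<mapsto> g y\<close> and taking real parts reduces the claim to real-linear functionals
  \<open>l\<close> on $C(X,E)$ with \<open>\<bar>l f\<bar> \<le> C \<parallel>f\<parallel>\<close>.  Let $K = X \times B$, where $B$ is the unit ball of
  the real dual of $E$ with the weak* topology; $K$ is compact and $f$ becomes the continuous function
  \<open>(x, \<phi>) \<mapsto> \<phi> (f x)\<close> on $K$.  Since $B$ is symmetric, \<open>l f \<le> C sup (\<phi> (f x))\<close>, so a
  Hahn-Banach extension of \<open>l\<close> to $C(K)$ dominated by \<open>G \<mapsto> C sup G\<close> is positive with mass at most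
  $C$, hence given by a measure on $K$.  The formula \<open>\<integral> \<phi> (f x)\<close> then makes sense on all of
  $M(X,E)$, keeps the norm bound, and dominated convergence gives the weak sequential continuity.

  Uniqueness, and with it linearity over the scalar field, holds because $M(X,E)$ is the closure of
  $C(X,E)$ under sums and bounded pointwise limits: the elements of $M(X,E)$ are strongly measurable
  by the Pettis theorem, so they are bounded limits of simple functions, and indicators of closed
  \<open>G\<^sub>\<delta>\<close> sets are limits of continuous functions by Urysohn's lemma.
\<close>

section \<open>A Hahn-Banach theorem\<close>

text \<open>Functionals on C(X,E) are in general vector measures. A positive scalar measure on X
  \<times> B, where the functional \<phi> is a second variable, avoids them: extending becomes
  integrating. The price is that neither the Hahn-Banach extension nor its measure is canonical.
  They are chosen separately for every y in F, so nothing makes the result additive in y, and the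
  construction makes measurable only the continuous functions on X \<times> B, not the pairing with
  a general f in M(X,E). The closure property behind uniqueness repairs both defects: an identity
  such as \<open>L (y + z) f = L y f + L z f\<close> needs checking on C(X,E) only, and
  measurability of the pairing is proved by the same induction. That the target is a dual with its
  weak* topology is what allows fixing y: convergence is tested at one y at a time.\<close>

definition sublinear_on :: "(real \<Rightarrow> 'v::ab_group_add \<Rightarrow> 'v) \<Rightarrow> 'v set \<Rightarrow> ('v \<Rightarrow> real) \<Rightarrow> bool" where
  "sublinear_on sc V q \<longleftrightarrow>
     (\<forall>x\<in>V. \<forall>y\<in>V. q (x + y) \<le> q x + q y) \<and> (\<forall>r>0. \<forall>x\<in>V. q (sc r x) \<le> r * q x)"

text \<open>Scalar multiplication and carrier are parameters because the theorem is applied to two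
  spaces: E with \<open>scaleR\<close>, and the functions continuous on X \<times> B with pointwise
  scaling.\<close>

locale real_subspace = vector_space scale
  for scale :: "real \<Rightarrow> 'v::ab_group_add \<Rightarrow> 'v" +
  fixes V :: "'v set"
  assumes subspace_V: "subspace V"
begin

lemma V_closed: "0 \<in> V" "x \<in> V \<Longrightarrow> y \<in> V \<Longrightarrow> x + y \<in> V" "x \<in> V \<Longrightarrow> scale r x \<in> V" "x \<in> V \<Longrightarrow> - x \<in> V"
  using subspace_V by (auto simp: subspace_0 subspace_add subspace_scale subspace_neg)

lemma sublinear_add: "sublinear_on scale V q \<Longrightarrow> x \<in> V \<Longrightarrow> y \<in> V \<Longrightarrow> q (x + y) \<le> q x + q y"
  by (simp add: sublinear_on_def)

lemma sublinear_0:
  assumes "sublinear_on scale V q" shows "q 0 = 0"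
proof -
  have "q 0 \<le> q 0 + q 0"
    using sublinear_add[OF assms, of 0 0] V_closed(1) by simp
  moreover have "q (scale (1/2) 0) \<le> 1/2 * q 0"
    using assms V_closed(1) unfolding sublinear_on_def by (metis half_gt_zero zero_less_one)
  ultimately show ?thesis by simp
qed

text \<open>Scaling back by \<open>1/r\<close> turns the defining inequality into its
  converse.\<close>

lemma sublinear_scale:
  assumes "sublinear_on scale V q" "x \<in> V" "0 \<le> r" shows "q (scale r x) = r * q x"
proof (cases "r = 0")
  case True
  then show ?thesis using sublinear_0[OF assms(1)] by simp
next
  case False
  with assms have r: "r > 0" by simp
  have le: "q (scale s y) \<le> s * q y" if "s > 0" "y \<in> V" for s y
    using assms that unfolding sublinear_on_def by blast
  have "q x = q (scale (1/r) (scale r x))" using r by simp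
  also have "\<dots> \<le> (1/r) * q (scale r x)"
    using r assms by (intro le) (auto intro: V_closed)
  finally have "r * q x \<le> q (scale r x)" using r by (simp add: field_simps)
  with le[OF r assms(2)] show ?thesis by simp
qed

lemma sublinear_neg:
  assumes "sublinear_on scale V q" "x \<in> V" shows "- q (- x) \<le> q x"
  using sublinear_add[OF assms(1), of x "- x"] sublinear_0[OF assms(1)] assms(2) V_closed(4)
  by simp

text \<open>A linear functional below \<open>q\<close> satisfies
  \<open>I x \<le> p (x + w) - c\<close>, which at \<open>x = - w\<close> reads
  \<open>c \<le> I w\<close>. So \<open>q\<close> builds the lower bounds listed in \<open>D\<close>
  into the majorant. It stays sublinear because \<open>D\<close> is closed under sums and positive
  multiples.\<close>

lemma sublinear_INF_cone:
  assumes p: "sublinear_on scale V p"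
    and D: "\<And>w c. (w, c) \<in> D \<Longrightarrow> w \<in> V \<and> c \<le> p w"
    and D0: "(0, 0) \<in> D"
    and Dadd: "\<And>w c v d. (w, c) \<in> D \<Longrightarrow> (v, d) \<in> D \<Longrightarrow> (w + v, c + d) \<in> D"
    and Dscale: "\<And>r w c. 0 < r \<Longrightarrow> (w, c) \<in> D \<Longrightarrow> (scale r w, r * c) \<in> D"
  defines "q \<equiv> \<lambda>x. INF (w, c)\<in>D. p (x + w) - c"
  shows "sublinear_on scale V q"
    and "\<And>x w c. x \<in> V \<Longrightarrow> (w, c) \<in> D \<Longrightarrow> q x \<le> p (x + w) - c"
proof -
  \<comment> \<open>Subadditivity and \<open>c \<le> p w\<close> give a bound independent of
    \<open>(w, c)\<close>, so the infimum is finite.\<close>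
  have lower: "- p (- x) \<le> p (x + w) - c" if "x \<in> V" "(w, c) \<in> D" for x w c
  proof -
    have "p ((x + w) + (- x)) \<le> p (x + w) + p (- x)"
      using that D by (intro sublinear_add[OF p]) (auto intro: V_closed)
    then show ?thesis using D[OF that(2)] by (simp add: algebra_simps)
  qed
  show q_le: "q x \<le> p (x + w) - c" if "x \<in> V" "(w, c) \<in> D" for x w c
    unfolding q_def using that lower
    by (intro cINF_lower2[where x = "(w, c)"] bdd_belowI[where m = "- p (- x)"]) auto
  have q_ge: "m \<le> q x" if "\<And>w c. (w, c) \<in> D \<Longrightarrow> m \<le> p (x + w) - c" for m x
    unfolding q_def using that D0 by (intro cINF_greatest) auto
  show "sublinear_on scale V q"
    unfolding sublinear_on_def
  proof (intro conjI ballI allI impI)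
    fix x y assume xy: "x \<in> V" "y \<in> V"
    \<comment> \<open>Moving one term at a time to the left splits the infimum over pairs into two
      successive infima.\<close>
    have "q (x + y) - q y \<le> q x"
    proof (rule q_ge)
      fix w c assume w: "(w, c) \<in> D"
      have "q (x + y) - (p (x + w) - c) \<le> q y"
      proof (rule q_ge)
        fix v d assume v: "(v, d) \<in> D"
        have "q (x + y) \<le> p ((x + y) + (w + v)) - (c + d)"
          using xy w v by (intro q_le Dadd) (auto intro: V_closed)
        also have "p ((x + y) + (w + v)) = p ((x + w) + (y + v))" by (simp add: algebra_simps)
        also have "\<dots> \<le> p (x + w) + p (y + v)"
          using xy w v D by (intro sublinear_add[OF p]) (auto intro: V_closed)
        finally show "q (x + y) - (p (x + w) - c) \<le> p (y + v) - d" by simp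
      qed
      then show "q (x + y) - q y \<le> p (x + w) - c" by simp
    qed
    then show "q (x + y) \<le> q x + q y" by simp
  next
    fix r :: real and x assume r: "0 < r" and x: "x \<in> V"
    have "q (scale r x) / r \<le> q x"
    proof (rule q_ge)
      fix w c assume w: "(w, c) \<in> D"
      have "q (scale r x) \<le> p (scale r x + scale r w) - r * c"
        using r x w by (intro q_le Dscale) (auto intro: V_closed)
      also have "p (scale r x + scale r w) = r * p (x + w)"
        using r x w D sublinear_scale[OF p, of "x + w" r] by (simp add: scale_right_distrib V_closed)
      finally show "q (scale r x) / r \<le> p (x + w) - c" using r by (simp add: field_simps)
    qed
    then show "q (scale r x) \<le> r * q x" using r by (simp add: field_simps)
  qed
qed

text \<open>A minimal sublinear functional is linear: minimality against the functional
  \<open>\<lambda>x. INF t\<ge>0. q (x + t a) - t q(a)\<close> yields \<open>q (- a) \<le> - q a\<close>.\<close>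

lemma exists_linear_below_sublinear:
  assumes p: "sublinear_on scale V p"
  obtains I where "\<And>x. x \<in> V \<Longrightarrow> I x \<le> p x"
    and "\<And>x y. x \<in> V \<Longrightarrow> y \<in> V \<Longrightarrow> I (x + y) = I x + I y"
    and "\<And>r x. x \<in> V \<Longrightarrow> I (scale r x) = r * I x"
proof -
  \<comment> \<open>Values off \<open>V\<close> are fixed to 0, so that order and equality within
    \<open>A\<close> depend on the values on \<open>V\<close> only.\<close>
  define A where "A = {q. sublinear_on scale V q \<and> (\<forall>x\<in>V. q x \<le> p x) \<and> (\<forall>x. x \<notin> V \<longrightarrow> q x = 0)}"
  \<comment> \<open>The order is reversed: the maximal element delivered by Zorn's lemma is a
    minimal functional.\<close>
  define P where "P = (\<lambda>a b :: 'v \<Rightarrow> real. \<forall>x. b x \<le> a x)"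
  have cut: "(\<lambda>x. if x \<in> V then q x else 0) \<in> A"
    if "sublinear_on scale V q" "\<And>x. x \<in> V \<Longrightarrow> q x \<le> p x" for q
    using that unfolding A_def sublinear_on_def by (auto simp: V_closed)
  have "\<exists>m\<in>A. \<forall>a\<in>A. P m a \<longrightarrow> a = m"
  proof (rule predicate_Zorn)
    show "partial_order_on A (relation_of P A)"
      by (rule partial_order_on_relation_ofI) (auto simp: P_def fun_eq_iff intro: order_trans antisym)
    fix C assume "C \<in> Chains (relation_of P A)"
    then have CA: "C \<subseteq> A" and chain: "\<And>a b. a \<in> C \<Longrightarrow> b \<in> C \<Longrightarrow> P a b \<or> P b a"
      by (auto simp: Chains_def relation_of_def)
    show "\<exists>u\<in>A. \<forall>a\<in>C. P a u"
    proof (cases "C = {}")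
      case True
      then show ?thesis using cut[OF p] by blast
    next
      case False
      define u where "u x = (INF q\<in>C. q x)" for x
      have sub: "sublinear_on scale V q" if "q \<in> C" for q using that CA by (auto simp: A_def)
      have lower: "- p (- x) \<le> q x" if "q \<in> C" "x \<in> V" for q x
      proof -
        have "q (- x) \<le> p (- x)" using that CA V_closed(4) by (auto simp: A_def)
        with sublinear_neg[OF sub[OF that(1)] that(2)] show ?thesis by simp
      qed
      have u_le: "u x \<le> q x" if "x \<in> V" "q \<in> C" for x q
        unfolding u_def using that lower
        by (intro cINF_lower bdd_belowI[where m = "- p (- x)"]) auto
      have u_ge: "m \<le> u x" if "\<And>q. q \<in> C \<Longrightarrow> m \<le> q x" for m x
        unfolding u_def using that False by (intro cINF_greatest) auto
      have sub_u: "sublinear_on scale V u"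
        unfolding sublinear_on_def
      proof (intro conjI ballI allI impI)
        fix x y assume xy: "x \<in> V" "y \<in> V"
        have "u (x + y) - u y \<le> u x"
        proof (rule u_ge)
          fix q1 assume q1: "q1 \<in> C"
          have "u (x + y) - q1 x \<le> u y"
          proof (rule u_ge)
            fix q2 assume q2: "q2 \<in> C"
            \<comment> \<open>In a chain the smaller of \<open>q1\<close> and \<open>q2\<close> lies
              below both, so the subadditivity of a single member suffices.\<close>
            obtain q where q: "q \<in> C" "q x \<le> q1 x" "q y \<le> q2 y"
              using chain[OF q1 q2] q1 q2 unfolding P_def by blast
            have "u (x + y) \<le> q (x + y)" using xy q by (intro u_le) (auto intro: V_closed)
            also have "\<dots> \<le> q x + q y" using xy q by (intro sublinear_add[OF sub])
            finally show "u (x + y) - q1 x \<le> q2 y" using q by simp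
          qed
          then show "u (x + y) - u y \<le> q1 x" by simp
        qed
        then show "u (x + y) \<le> u x + u y" by simp
      next
        fix r :: real and x assume r: "0 < r" and x: "x \<in> V"
        have "u (scale r x) / r \<le> u x"
        proof (rule u_ge)
          fix q assume q: "q \<in> C"
          have "u (scale r x) \<le> q (scale r x)" using x q by (intro u_le) (auto intro: V_closed)
          also have "\<dots> = r * q x" using r x by (intro sublinear_scale[OF sub[OF q]]) auto
          finally show "u (scale r x) / r \<le> q x" using r by (simp add: field_simps)
        qed
        then show "u (scale r x) \<le> r * u x" using r by (simp add: field_simps)
      qed
      obtain q0 where q0: "q0 \<in> C" using False by blast
      have "u x \<le> p x" if "x \<in> V" for x
        using u_le[OF that q0] q0 CA that by (force simp: A_def)
      from cut[OF sub_u this] have "(\<lambda>x. if x \<in> V then u x else 0) \<in> A" by blast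
      moreover have "P a (\<lambda>x. if x \<in> V then u x else 0)" if "a \<in> C" for a
        using that CA u_le by (auto simp: P_def A_def)
      ultimately show ?thesis by blast
    qed
  qed
  then obtain m where mA: "m \<in> A" and min: "\<And>a. a \<in> A \<Longrightarrow> P m a \<Longrightarrow> a = m" by blast
  have sub: "sublinear_on scale V m" and m_le: "\<And>x. x \<in> V \<Longrightarrow> m x \<le> p x"
    and m0: "\<And>x. x \<notin> V \<Longrightarrow> m x = 0"
    using mA by (auto simp: A_def)
  have neg: "m (- a) = - m a" if a: "a \<in> V" for a
  proof -
    define D where "D = {(scale t a, t * m a) |t. 0 \<le> t}"
    define q where "q x = (INF (w, c)\<in>D. m (x + w) - c)" for x
    have D: "(w, c) \<in> D \<Longrightarrow> w \<in> V \<and> c \<le> m w" for w c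
      using a sublinear_scale[OF sub] by (auto simp: D_def intro: V_closed)
    have D0: "(0, 0) \<in> D" unfolding D_def by (auto intro!: exI[of _ 0])
    have Dadd: "(w + v, c + d) \<in> D" if "(w, c) \<in> D" "(v, d) \<in> D" for w c v d
    proof -
      from that obtain s t where "w = scale s a" "c = s * m a" "v = scale t a" "d = t * m a" "0 \<le> s" "0 \<le> t"
        by (auto simp: D_def)
      then show ?thesis unfolding D_def
        by (auto intro!: exI[of _ "s + t"] simp: scale_left_distrib algebra_simps)
    qed
    have Dscale: "(scale r w, r * c) \<in> D" if "0 < r" "(w, c) \<in> D" for r w c
    proof -
      from that obtain t where "w = scale t a" "c = t * m a" "0 \<le> t"
        by (auto simp: D_def)
      then show ?thesis using that unfolding D_def
        by (auto intro!: exI[of _ "r * t"])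
    qed
    have q: "sublinear_on scale V q" and q_le: "\<And>x w c. x \<in> V \<Longrightarrow> (w, c) \<in> D \<Longrightarrow> q x \<le> m (x + w) - c"
      unfolding q_def using sublinear_INF_cone[OF sub D D0 Dadd Dscale] by blast+
    have qm: "q x \<le> m x" if "x \<in> V" for x
      using q_le[OF that D0] by simp
    have "q x \<le> p x" if "x \<in> V" for x
      using qm[OF that] m_le[OF that] by simp
    then have m_eq: "(\<lambda>x. if x \<in> V then q x else 0) = m"
      using min[OF cut[OF q]] by (simp add: P_def m0 qm)
    have "m (- a) = q (- a)" using fun_cong[OF m_eq, of "- a"] V_closed(4)[OF a] by simp
    also have "\<dots> \<le> m (- a + a) - m a"
      using a by (intro q_le V_closed) (auto simp: D_def intro!: exI[of _ 1])
    finally have "m (- a) \<le> - m a" using sublinear_0[OF sub] by simp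
    with sublinear_neg[OF sub a] show ?thesis by simp
  qed
  show ?thesis
  proof (rule that[of m])
    fix x y assume xy: "x \<in> V" "y \<in> V"
    \<comment> \<open>Since \<open>m\<close> is odd, subadditivity at the negatives is the missing
      inequality.\<close>
    have "m (- x + - y) \<le> m (- x) + m (- y)"
      using xy by (intro sublinear_add[OF sub] V_closed)
    moreover have "m (- x + - y) = - m (x + y)"
      using neg[of "x + y"] xy V_closed(2) by simp
    ultimately show "m (x + y) = m x + m y"
      using neg xy sublinear_add[OF sub xy] by simp
  next
    fix r :: real and x assume x: "x \<in> V"
    show "m (scale r x) = r * m x"
    proof (cases "0 \<le> r")
      case True then show ?thesis using sublinear_scale[OF sub x] by simp
    next
      case False
      then have "m (scale (- r) (- x)) = (- r) * m (- x)"
        using x by (intro sublinear_scale[OF sub] V_closed) auto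
      then show ?thesis using neg[OF x] by simp
    qed
  qed (use m_le in auto)
qed

text \<open>Elements \<open>(w, c)\<close> of the cone \<open>D\<close> prescribe the lower bounds \<open>c \<le> I w\<close>; if also \<open>(- w, - c) \<in> D\<close>,
  this prescribes the value \<open>I w = c\<close>.\<close>

theorem hahn_banach_cone:
  assumes p: "sublinear_on scale V p"
    and D: "\<And>w c. (w, c) \<in> D \<Longrightarrow> w \<in> V \<and> c \<le> p w"
    and D0: "(0, 0) \<in> D"
    and Dadd: "\<And>w c v d. (w, c) \<in> D \<Longrightarrow> (v, d) \<in> D \<Longrightarrow> (w + v, c + d) \<in> D"
    and Dscale: "\<And>r w c. 0 < r \<Longrightarrow> (w, c) \<in> D \<Longrightarrow> (scale r w, r * c) \<in> D"
  obtains I where "\<And>x. x \<in> V \<Longrightarrow> I x \<le> p x"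
    and "\<And>x y. x \<in> V \<Longrightarrow> y \<in> V \<Longrightarrow> I (x + y) = I x + I y"
    and "\<And>r x. x \<in> V \<Longrightarrow> I (scale r x) = r * I x"
    and "\<And>w c. (w, c) \<in> D \<Longrightarrow> c \<le> I w"
proof -
  define q where "q x = (INF (w, c)\<in>D. p (x + w) - c)" for x
  have q: "sublinear_on scale V q" and q_le: "\<And>x w c. x \<in> V \<Longrightarrow> (w, c) \<in> D \<Longrightarrow> q x \<le> p (x + w) - c"
    unfolding q_def using sublinear_INF_cone[OF p D D0 Dadd Dscale] by blast+
  obtain I where I: "\<And>x. x \<in> V \<Longrightarrow> I x \<le> q x"
    and Iadd: "\<And>x y. x \<in> V \<Longrightarrow> y \<in> V \<Longrightarrow> I (x + y) = I x + I y"
    and Iscale: "\<And>r x. x \<in> V \<Longrightarrow> I (scale r x) = r * I x"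
    using exists_linear_below_sublinear[OF q] by metis
  show ?thesis
  proof (rule that[of I, OF _ Iadd Iscale])
    show "I x \<le> p x" if "x \<in> V" for x
      using I[OF that] q_le[OF that D0] by simp
    show "c \<le> I w" if wc: "(w, c) \<in> D" for w c
    proof -
      have w: "w \<in> V" using D wc by blast
      have "I (- w) \<le> p (- w + w) - c"
        using I[of "- w"] q_le[OF _ wc, of "- w"] V_closed(4)[OF w] by simp
      moreover have "I (- w) = - I w" using Iscale[OF w, of "-1"] by simp
      ultimately show ?thesis using sublinear_0[OF p] by simp
    qed
  qed
qed

end

section \<open>The Daniell-Stone representation\<close>

text \<open>The functions are total, but only their values on \<open>\<Omega>\<close> count:
  \<open>I_nonneg\<close> for both differences shows that \<open>I\<close> agrees on functions that
  agree there.\<close>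

locale daniell_functional =
  fixes \<Omega> :: "'a set" and L :: "('a \<Rightarrow> real) set" and I :: "('a \<Rightarrow> real) \<Rightarrow> real"
  assumes add_L: "f \<in> L \<Longrightarrow> g \<in> L \<Longrightarrow> (\<lambda>x. f x + g x) \<in> L"
    and scale_L: "f \<in> L \<Longrightarrow> (\<lambda>x. c * f x) \<in> L"
    and min_L: "f \<in> L \<Longrightarrow> g \<in> L \<Longrightarrow> (\<lambda>x. min (f x) (g x)) \<in> L"
    and one_L: "(\<lambda>x. 1) \<in> L"
    and bounded_L: "f \<in> L \<Longrightarrow> \<exists>B. \<forall>x\<in>\<Omega>. \<bar>f x\<bar> \<le> B"
    and I_add: "f \<in> L \<Longrightarrow> g \<in> L \<Longrightarrow> I (\<lambda>x. f x + g x) = I f + I g"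
    and I_scale: "f \<in> L \<Longrightarrow> I (\<lambda>x. c * f x) = c * I f"
    and I_nonneg: "f \<in> L \<Longrightarrow> (\<And>x. x \<in> \<Omega> \<Longrightarrow> 0 \<le> f x) \<Longrightarrow> 0 \<le> I f"
    and I_smooth: "(\<And>n. u n \<in> L) \<Longrightarrow> (\<And>x. x \<in> \<Omega> \<Longrightarrow> decseq (\<lambda>n. u n x)) \<Longrightarrow>
       (\<And>x. x \<in> \<Omega> \<Longrightarrow> (\<lambda>n. u n x) \<longlonglongrightarrow> 0) \<Longrightarrow> (\<lambda>n. I (u n)) \<longlonglongrightarrow> 0"
begin

lemma const_L: "(\<lambda>x. c) \<in> L"
  using scale_L[OF one_L, of c] by simp

lemma diff_L: "f \<in> L \<Longrightarrow> g \<in> L \<Longrightarrow> (\<lambda>x. f x - g x) \<in> L"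
  using add_L[OF _ scale_L[of g "-1"], of f] by simp

lemma max_L: "f \<in> L \<Longrightarrow> g \<in> L \<Longrightarrow> (\<lambda>x. max (f x) (g x)) \<in> L"
proof -
  assume f: "f \<in> L" and g: "g \<in> L"
  have "(\<lambda>x. f x + g x - min (f x) (g x)) \<in> L" by (intro diff_L add_L min_L f g)
  moreover have "f x + g x - min (f x) (g x) = max (f x) (g x)" for x by (simp add: min_def max_def)
  ultimately show ?thesis by simp
qed

lemma I_diff: "f \<in> L \<Longrightarrow> g \<in> L \<Longrightarrow> I (\<lambda>x. f x - g x) = I f - I g"
  using I_add[OF _ scale_L[of g "-1"], of f] I_scale[of g "-1"] by simp

lemma I_mono: "f \<in> L \<Longrightarrow> g \<in> L \<Longrightarrow> (\<And>x. x \<in> \<Omega> \<Longrightarrow> f x \<le> g x) \<Longrightarrow> I f \<le> I g"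
  using I_nonneg[OF diff_L, of g f] by (simp add: I_diff)

lemma sum_L: "(\<And>k. k \<in> S \<Longrightarrow> f k \<in> L) \<Longrightarrow> (\<lambda>x. \<Sum>k\<in>S. f k x) \<in> L"
  and I_sum: "(\<And>k. k \<in> S \<Longrightarrow> f k \<in> L) \<Longrightarrow> I (\<lambda>x. \<Sum>k\<in>S. f k x) = (\<Sum>k\<in>S. I (f k))"
proof (induction S rule: infinite_finite_induct)
  case (infinite S)
  { case 1 show ?case using infinite const_L[of 0] by simp }
  { case 2 show ?case using infinite I_scale[OF one_L, of 0] by simp }
next
  case empty
  { case 1 show ?case using const_L[of 0] by simp }
  { case 2 show ?case using I_scale[OF one_L, of 0] by simp }
next
  case (insert k S)
  { case 1 then show ?case using insert by (simp add: add_L) }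
  { case 2 then show ?case using insert by (simp add: I_add) }
qed

text \<open>\<open>covers h A\<close>: the functions \<open>h n\<close> increase to a limit that is at least the indicator of \<open>A\<close>.\<close>

definition covers :: "(nat \<Rightarrow> 'a \<Rightarrow> real) \<Rightarrow> 'a set \<Rightarrow> bool" where
  "covers h A \<longleftrightarrow> (\<forall>n. h n \<in> L) \<and> (\<forall>x\<in>\<Omega>. incseq (\<lambda>n. h n x) \<and> 0 \<le> h 0 x) \<and>
     (\<forall>x\<in>A. \<forall>c<1. \<exists>n. c < h n x)"

text \<open>Daniell's upper integral of the indicator of \<open>A\<close>. Increasing sequences
  instead of single functions make it countably subadditive, because sums of countably many covers
  are covers again.\<close>

definition outer :: "'a set \<Rightarrow> ennreal" where
  "outer A = (INF h\<in>{h. covers h A}. SUP n. ennreal (I (h n)))"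

lemma covers_nonneg: "covers h A \<Longrightarrow> x \<in> \<Omega> \<Longrightarrow> 0 \<le> h n x"
  unfolding covers_def incseq_def by (meson le0 order_trans)

lemma covers_I_nonneg: "covers h A \<Longrightarrow> 0 \<le> I (h n)"
  by (rule I_nonneg) (auto simp: covers_nonneg, simp add: covers_def)

lemma outer_le: "covers h A \<Longrightarrow> outer A \<le> (SUP n. ennreal (I (h n)))"
  unfolding outer_def by (rule INF_lower) simp

lemma outer_le_I:
  assumes "g \<in> L" "\<And>x. x \<in> \<Omega> \<Longrightarrow> 0 \<le> g x" "\<And>x. x \<in> A \<Longrightarrow> 1 \<le> g x"
  shows "outer A \<le> ennreal (I g)"
proof -
  have "covers (\<lambda>_. g) A"
    using assms by (force simp: covers_def intro: incseq_const)
  from outer_le[OF this] show ?thesis by simp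
qed

text \<open>The excess of \<open>g\<close> over \<open>h n\<close> decreases to 0 on
  \<open>\<Omega>\<close>, so its integral vanishes in the limit. This is where
  \<open>I_smooth\<close> enters. The assumption \<open>covers h {}\<close> merely says that
  \<open>h\<close> is an increasing nonnegative sequence in \<open>L\<close>.\<close>

lemma I_le_SUP:
  assumes g: "g \<in> L" and h: "covers h {}"
    and le: "\<And>x c. x \<in> \<Omega> \<Longrightarrow> c < g x \<Longrightarrow> \<exists>n. c < h n x"
  shows "ennreal (I g) \<le> (SUP n. ennreal (I (h n)))" (is "_ \<le> ?S")
proof -
  have hL: "h n \<in> L" for n using h by (simp add: covers_def)
  define u where "u n x = g x - min (g x) (h n x)" for n x
  have "(\<lambda>n. I (u n)) \<longlonglongrightarrow> 0"
  proof (rule I_smooth)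
    show "u n \<in> L" for n unfolding u_def by (intro diff_L min_L g hL)
    fix x assume x: "x \<in> \<Omega>"
    have inc: "incseq (\<lambda>n. h n x)" using h x by (simp add: covers_def)
    then show "decseq (\<lambda>n. u n x)"
      by (fastforce simp: u_def decseq_def incseq_def)
    show "(\<lambda>n. u n x) \<longlonglongrightarrow> 0"
    proof (rule LIMSEQ_I)
      fix r :: real assume "0 < r"
      then obtain n where n: "g x - r < h n x" using le[OF x, of "g x - r"] by auto
      have "norm (u m x - 0) < r" if "n \<le> m" for m
      proof -
        have "h n x \<le> h m x" using inc that by (auto simp: incseq_def)
        then show ?thesis using n \<open>0 < r\<close> by (auto simp: u_def)
      qed
      then show "\<exists>no. \<forall>m\<ge>no. norm (u m x - 0) < r" by blast
    qed
  qed
  then have "(\<lambda>n. ennreal (I (u n)) + ?S) \<longlonglongrightarrow> ennreal 0 + ?S"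
    by (intro tendsto_add tendsto_ennrealI tendsto_const)
  moreover have "ennreal (I g) \<le> ennreal (I (u n)) + ?S" for n
  proof -
    have u: "u n \<in> L" unfolding u_def by (intro diff_L min_L g hL)
    have "I g \<le> I (\<lambda>x. u n x + h n x)"
      by (rule I_mono[OF g add_L[OF u hL]]) (auto simp: u_def)
    also have "\<dots> = I (u n) + I (h n)" by (rule I_add[OF u hL])
    finally have "ennreal (I g) \<le> ennreal (I (u n) + I (h n))" by (rule ennreal_leI)
    also have "\<dots> = ennreal (I (u n)) + ennreal (I (h n))"
      using covers_I_nonneg[OF h] I_nonneg[OF u] by (simp add: u_def)
    also have "\<dots> \<le> ennreal (I (u n)) + ?S"
      by (intro add_left_mono SUP_upper) auto
    finally show ?thesis .
  qed
  ultimately show ?thesis by (auto intro!: LIMSEQ_le_const)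
qed

text \<open>Every cover of \<open>A\<close> eventually exceeds any number below \<open>g\<close>: on
  \<open>A\<close> because it comes close to 1, elsewhere because it is nonnegative. Together with
  \<open>outer_le_I\<close> this traps the outer measure between functions below and above the
  indicator.\<close>

lemma I_le_outer:
  assumes g: "g \<in> L" and "\<And>x. x \<in> \<Omega> \<Longrightarrow> g x \<le> 1" and "\<And>x. x \<in> \<Omega> - A \<Longrightarrow> g x \<le> 0"
  shows "ennreal (I g) \<le> outer A"
  unfolding outer_def
proof (rule INF_greatest)
  fix h assume "h \<in> {h. covers h A}"
  then have h: "covers h A" by simp
  show "ennreal (I g) \<le> (SUP n. ennreal (I (h n)))"
  proof (rule I_le_SUP[OF g])
    show "covers h {}" using h by (simp add: covers_def)
    fix x c assume x: "x \<in> \<Omega>" and c: "c < g x"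
    show "\<exists>n. c < h n x"
    proof (cases "x \<in> A")
      case True
      then show ?thesis using h c assms(2)[OF x] by (auto simp: covers_def)
    next
      case False
      then show ?thesis using c assms(3)[of x] x covers_nonneg[OF h x, of 0] by (intro exI[of _ 0]) auto
    qed
  qed
qed

lemma outer_measure_space_outer: "outer_measure_space (Pow \<Omega>) outer"
proof -
  have "outer {} = 0"
    using outer_le_I[OF const_L[of 0], of "{}"] I_scale[OF one_L, of 0] by simp
  then have "positive (Pow \<Omega>) outer" by (simp add: positive_def)
  moreover have "increasing (Pow \<Omega>) outer"
    unfolding increasing_def outer_def by (auto intro!: INF_superset_mono simp: covers_def)
  moreover have "countably_subadditive (Pow \<Omega>) outer"
    unfolding countably_subadditive_def
  proof (intro allI impI, rule ennreal_le_epsilon)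
    fix A :: "nat \<Rightarrow> 'a set" and e :: real
    assume A: "range A \<subseteq> Pow \<Omega>" and e: "0 < e" and fin: "(\<Sum>n. outer (A n)) < top"
    then have *: "outer (A n) < outer (A n) + e * (1/2)^Suc n" for n
      by (auto simp add: less_top dest!: ennreal_suminf_lessD)
    have "\<exists>h. covers h (A n) \<and> (SUP k. ennreal (I (h k))) < outer (A n) + e * (1/2)^Suc n" for n
      using *[of n] unfolding outer_def[of "A n"] INF_less_iff by auto
    then obtain h where h: "\<And>n. covers (h n) (A n)"
      and hS: "\<And>n. (SUP k. ennreal (I (h n k))) < outer (A n) + e * (1/2)^Suc n"
      by metis
    have hL: "h n k \<in> L" for n k using h by (simp add: covers_def)
    \<comment> \<open>The sum is diagonal: stage \<open>n\<close> uses the \<open>n\<close>-th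
      member of the first \<open>n\<close> covers, so both the number of terms and each term
      grow.\<close>
    define H where "H n x = (\<Sum>k<n. h k n x)" for n x
    have "covers H (\<Union>i. A i)"
      unfolding covers_def
    proof (intro conjI allI ballI impI)
      show "H n \<in> L" for n unfolding H_def by (intro sum_L hL)
      fix x assume x: "x \<in> \<Omega>"
      show "incseq (\<lambda>n. H n x)"
      proof (rule incseq_SucI)
        fix n
        have "H n x \<le> (\<Sum>k<n. h k (Suc n) x)"
          unfolding H_def using h x by (intro sum_mono) (auto simp: covers_def incseq_def)
        also have "\<dots> \<le> H (Suc n) x"
          unfolding H_def using covers_nonneg[OF h x] by simp
        finally show "H n x \<le> H (Suc n) x" .
      qed
      show "0 \<le> H 0 x" by (simp add: H_def)
    next
      fix x and c :: real assume x: "x \<in> (\<Union>i. A i)" and "c < 1"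
      then obtain i n where i: "x \<in> A i" "c < h i n x" using h by (fastforce simp: covers_def)
      have "x \<in> \<Omega>" using A x by auto
      \<comment> \<open>\<open>Suc i\<close> makes the term with index \<open>i\<close> occur in the
        sum, and \<open>n\<close> makes that term large enough.\<close>
      define m where "m = max (Suc i) n"
      have "h i n x \<le> h i m x" using h \<open>x \<in> \<Omega>\<close> by (auto simp: covers_def incseq_def m_def)
      also have "\<dots> \<le> H m x"
        unfolding H_def by (rule member_le_sum) (auto simp: m_def covers_nonneg[OF h \<open>x \<in> \<Omega>\<close>])
      finally show "\<exists>n. c < H n x" using i(2) by (intro exI[of _ m]) simp
    qed
    from outer_le[OF this] have "outer (\<Union>i. A i) \<le> (SUP n. ennreal (I (H n)))" .
    also have "\<dots> \<le> (\<Sum>n. outer (A n) + e * (1/2)^Suc n)"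
    proof (rule SUP_least)
      fix n
      have "ennreal (I (H n)) = (\<Sum>k<n. ennreal (I (h k n)))"
        unfolding H_def using covers_I_nonneg[OF h] by (simp add: I_sum[OF hL] sum_ennreal)
      also have "\<dots> \<le> (\<Sum>k<n. outer (A k) + e * (1/2)^Suc k)"
        by (intro sum_mono order_trans[OF SUP_upper less_imp_le[OF hS]]) auto
      also have "\<dots> \<le> (\<Sum>n. outer (A n) + e * (1/2)^Suc n)"
        by (intro sum_le_suminf) auto
      finally show "ennreal (I (H n)) \<le> (\<Sum>n. outer (A n) + e * (1/2)^Suc n)" .
    qed
    also have "\<dots> = (\<Sum>n. outer (A n)) + (\<Sum>n. ennreal e * ennreal ((1/2) ^ Suc n))"
      using e by (subst suminf_add[symmetric])
        (auto simp del: ennreal_suminf_cmult simp add: ennreal_mult[symmetric])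
    also have "\<dots> = (\<Sum>n. outer (A n)) + e"
      unfolding ennreal_suminf_cmult
      by (subst suminf_ennreal_eq[OF zero_le_power power_half_series]) auto
    finally show "outer (\<Union>i. A i) \<le> (\<Sum>n. outer (A n)) + e" .
  qed
  ultimately show ?thesis by (simp add: outer_measure_space_def)
qed

text \<open>The functions \<open>u m\<close> increase to the indicator of the superlevel set. They
  split a cover of \<open>T\<close> into its minimum with \<open>u\<close>, which covers the part
  inside, and the remainder, which covers the part outside. This gives Caratheodory's
  criterion.\<close>

lemma superlevel_in_lambda_system:
  assumes f: "f \<in> L"
  shows "{x\<in>\<Omega>. c < f x} \<in> lambda_system \<Omega> (Pow \<Omega>) outer" (is "?A \<in> _")
proof -
  interpret Pow: sigma_algebra \<Omega> "Pow \<Omega>" by (rule sigma_algebra_Pow)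
  define u where "u m x = min 1 (real m * max 0 (f x - c))" for m :: nat and x
  have uL: "u m \<in> L" for m
    unfolding u_def by (intro min_L scale_L max_L diff_L const_L f)
  have u_inc: "incseq (\<lambda>m. u m x)" for x
    unfolding u_def by (intro monoI min.mono mult_right_mono order_refl) auto
  have u0: "0 \<le> u m x" for x m by (simp add: u_def)
  have u_eq: "\<exists>m. u m x = 1" if less: "c < f x" for x
  proof -
    obtain m where "1 < real m * (f x - c)"
      using less reals_Archimedean3[of "f x - c"] by auto
    then show ?thesis using less by (auto simp: u_def intro!: exI[of _ m])
  qed
  have "outer (?A \<inter> T) + outer ((\<Omega> - ?A) \<inter> T) = outer T" if T: "T \<in> Pow \<Omega>" for T
  proof (rule antisym)
    show "outer (?A \<inter> T) + outer ((\<Omega> - ?A) \<inter> T) \<le> outer T"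
      unfolding outer_def[of T]
    proof (rule INF_greatest)
      fix h assume "h \<in> {h. covers h T}"
      then have h: "covers h T" by simp
      have hL: "h n \<in> L" for n using h by (simp add: covers_def)
      have h_inc: "x \<in> \<Omega> \<Longrightarrow> m \<le> n \<Longrightarrow> h m x \<le> h n x" for x m n
        using h by (auto simp: covers_def incseq_def)
      define a where "a m = ennreal (I (\<lambda>x. min (h m x) (u m x)))" for m
      let ?S = "SUP n. ennreal (I (h n))"
      have "covers (\<lambda>n x. min (h n x) (u n x)) (?A \<inter> T)"
        unfolding covers_def
      proof (intro conjI allI ballI impI)
        fix x and d :: real assume x: "x \<in> ?A \<inter> T" and d: "d < 1"
        obtain n where n: "d < h n x" using h x d unfolding covers_def by blast
        obtain m where m: "u m x = 1" using u_eq[of x] x by auto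
        have "h n x \<le> h (max m n) x" "u m x \<le> u (max m n) x"
          using x u_inc[of x] by (auto intro!: h_inc simp: incseq_def)
        then show "\<exists>n. d < min (h n x) (u n x)"
          using n m d by (intro exI[of _ "max m n"]) auto
      qed (auto intro!: min_L hL uL simp: incseq_def covers_nonneg[OF h] u0
          intro: min.coboundedI1 min.coboundedI2 h_inc incseqD[OF u_inc])
      from outer_le[OF this] have 1: "outer (?A \<inter> T) \<le> (SUP m. a m)" by (simp add: a_def)
      \<comment> \<open>Here \<open>m\<close> stays fixed while \<open>n\<close> grows, since
        \<open>h n - min (h n) (u n)\<close> need not increase with \<open>n\<close>. As every
        \<open>u m\<close> vanishes outside the set, nothing is lost; the supremum over
        \<open>m\<close> is taken at the end.\<close>
      have 2: "a m + outer ((\<Omega> - ?A) \<inter> T) \<le> ?S" for m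
      proof -
        define v where "v n x = h n x - min (h n x) (u m x)" for n x
        have vL: "v n \<in> L" for n unfolding v_def by (intro diff_L min_L hL uL)
        have v_inc: "v k x \<le> v n x" if "k \<le> n" "x \<in> \<Omega>" for k n x
          using h_inc[OF that(2,1)] by (auto simp: v_def)
        have v: "covers v ((\<Omega> - ?A) \<inter> T)"
          unfolding covers_def
        proof (intro conjI allI ballI impI)
          fix x and d :: real assume x: "x \<in> (\<Omega> - ?A) \<inter> T" and d: "d < 1"
          then have "u m x = 0" by (auto simp: u_def)
          moreover obtain n where "d < h n x" using h x d unfolding covers_def by blast
          ultimately show "\<exists>n. d < v n x"
            using covers_nonneg[OF h, of x] x by (intro exI[of _ n]) (auto simp: v_def min_def)
        qed (auto intro!: vL v_inc simp: incseq_def, simp add: v_def)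
        have "a m + outer ((\<Omega> - ?A) \<inter> T) \<le> a m + (SUP n. ennreal (I (v n)))"
          by (intro add_left_mono outer_le v)
        also have "\<dots> = (SUP n. a m + ennreal (I (v n)))"
          by (simp add: ennreal_SUP_add_right)
        also have "\<dots> \<le> ?S"
        proof (rule SUP_least)
          fix n
          \<comment> \<open>At the common index \<open>k\<close> the minimum with \<open>u m\<close>
            and the remainder add up to exactly \<open>h k\<close>.\<close>
          define k where "k = max m n"
          have "I (\<lambda>x. min (h m x) (u m x)) + I (v n) = I (\<lambda>x. min (h m x) (u m x) + v n x)"
            by (intro I_add[symmetric] min_L hL uL vL)
          also have "\<dots> \<le> I (h k)"
          proof (rule I_mono)
            fix x assume x: "x \<in> \<Omega>"
            have "min (h m x) (u m x) \<le> min (h k x) (u m x)"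
              using x by (intro min.mono h_inc order_refl) (simp_all add: k_def)
            moreover have "v n x \<le> v k x"
              using x by (intro v_inc) (simp_all add: k_def)
            ultimately show "min (h m x) (u m x) + v n x \<le> h k x" by (simp add: v_def)
          qed (intro add_L min_L hL uL vL)+
          finally have "I (\<lambda>x. min (h m x) (u m x)) + I (v n) \<le> I (h k)" .
          moreover have "0 \<le> I (\<lambda>x. min (h m x) (u m x))"
            by (intro I_nonneg min_L hL uL) (auto simp: covers_nonneg[OF h] u0)
          ultimately have "a m + ennreal (I (v n)) \<le> ennreal (I (h k))"
            unfolding a_def using covers_I_nonneg[OF v, of n]
            by (simp add: ennreal_leI del: ennreal_plus flip: ennreal_plus)
          also have "\<dots> \<le> ?S" by (rule SUP_upper) simp
          finally show "a m + ennreal (I (v n)) \<le> ?S" .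
        qed
        finally show ?thesis .
      qed
      have "outer (?A \<inter> T) + outer ((\<Omega> - ?A) \<inter> T) \<le> (SUP m. a m) + outer ((\<Omega> - ?A) \<inter> T)"
        by (intro add_right_mono 1)
      also have "\<dots> = (SUP m. a m + outer ((\<Omega> - ?A) \<inter> T))"
        by (rule ennreal_SUP_add_left[symmetric]) simp
      also have "\<dots> \<le> ?S" by (intro SUP_least 2)
      finally show "outer (?A \<inter> T) + outer ((\<Omega> - ?A) \<inter> T) \<le> ?S" .
    qed
    have "outer ((?A \<inter> T) \<union> ((\<Omega> - ?A) \<inter> T)) \<le> outer (?A \<inter> T) + outer ((\<Omega> - ?A) \<inter> T)"
      using outer_measure_space_outer T
      by (intro Pow.countably_subadditive_subadditive[THEN subadditiveD])
        (auto simp: outer_measure_space_def)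
    moreover have "(?A \<inter> T) \<union> ((\<Omega> - ?A) \<inter> T) = T" using T by auto
    ultimately show "outer T \<le> outer (?A \<inter> T) + outer ((\<Omega> - ?A) \<inter> T)" by simp
  qed
  then show ?thesis by (auto simp: lambda_system_def)
qed

text \<open>Proving \<open>I f \<le> integral\<^sup>L M f\<close> for all \<open>f\<close> is
  enough, since \<open>- f\<close> gives the converse. An affine change of \<open>f\<close>,
  harmless because \<open>I\<close> and the integral agree on constants, reduces this to values in
  the unit interval.\<close>

theorem daniell_stone:
  obtains M where "space M = \<Omega>" "finite_measure M" "measure M \<Omega> = I (\<lambda>x. 1)"
    and "\<And>f. f \<in> L \<Longrightarrow> f \<in> borel_measurable M"
    and "\<And>f. f \<in> L \<Longrightarrow> integral\<^sup>L M f = I f"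
proof -
  define \<Lambda> where "\<Lambda> = lambda_system \<Omega> (Pow \<Omega>) outer"
  have ms: "measure_space \<Omega> \<Lambda> outer"
    unfolding \<Lambda>_def
    by (rule sigma_algebra.caratheodory_lemma[OF sigma_algebra_Pow outer_measure_space_outer])
  then have sa: "sigma_algebra \<Omega> \<Lambda>" by (simp add: measure_space_def)
  define M where "M = measure_of \<Omega> \<Lambda> outer"
  have sub: "\<Lambda> \<subseteq> Pow \<Omega>" by (auto simp: \<Lambda>_def lambda_system_def)
  have space: "space M = \<Omega>" unfolding M_def using sub by (rule space_measure_of)
  have sets: "sets M = \<Lambda>"
    unfolding M_def using sa by (rule sigma_algebra.sets_measure_of_eq)
  have em: "emeasure M A = outer A" if "A \<in> \<Lambda>" for A
    unfolding M_def using ms that by (intro emeasure_measure_of_sigma) (auto simp: measure_space_def)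
  have \<Omega>: "\<Omega> \<in> \<Lambda>" using sets.top[of M] by (simp add: space sets)
  have "ennreal (I (\<lambda>x. 1)) \<le> outer \<Omega>" by (rule I_le_outer[OF one_L]) auto
  moreover have "outer \<Omega> \<le> ennreal (I (\<lambda>x. 1))" by (rule outer_le_I[OF one_L]) auto
  ultimately have em\<Omega>: "emeasure M \<Omega> = ennreal (I (\<lambda>x. 1))" using em[OF \<Omega>] by (simp add: antisym)
  then have fin: "finite_measure M" by (intro finite_measureI) (simp add: space)
  interpret finite_measure M by (rule fin)
  have I1: "measure M \<Omega> = I (\<lambda>x. 1)"
    using em\<Omega> I_nonneg[OF one_L] by (simp add: measure_def)
  have A: "{x\<in>\<Omega>. c < f x} \<in> sets M" if "f \<in> L" for f c
    unfolding sets \<Lambda>_def using that by (rule superlevel_in_lambda_system)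
  have meas: "f \<in> borel_measurable M" if "f \<in> L" for f
    unfolding borel_measurable_iff_greater space using A[OF that] by simp
  have int: "integrable M f" if f: "f \<in> L" for f
  proof -
    obtain B where "\<forall>x\<in>\<Omega>. \<bar>f x\<bar> \<le> B" using bounded_L[OF f] by blast
    then show ?thesis
      by (intro integrable_const_bound[where B = B] meas f AE_I2) (simp add: space)
  qed
  \<comment> \<open>Cut \<open>f\<close> into layers \<open>s k / N\<close> with \<open>indicator (A (Suc k)) \<le> s k \<le> indicator (A k)\<close>; the
    errors telescope to at most \<open>measure M \<Omega> / N\<close>.\<close>
  have unit: "I f \<le> integral\<^sup>L M f" if f: "f \<in> L" and f01: "\<And>x. x \<in> \<Omega> \<Longrightarrow> 0 \<le> f x \<and> f x \<le> 1" for f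
  proof -
    have "I f - integral\<^sup>L M f \<le> measure M \<Omega> / real (Suc K)" for K
    proof -
      define N where "N = Suc K"
      define s where "s k x = real N * (min (f x) ((real k + 1) / N) - min (f x) (real k / N))"
        for k :: nat and x
      define A where "A k = {x\<in>\<Omega>. real k / N < f x}" for k :: nat
      have N: "0 < real N" by (simp add: N_def)
      have sL: "s k \<in> L" for k unfolding s_def by (intro scale_L diff_L min_L f const_L)
      have s_le: "s k x \<le> 1" and s_zero: "f x \<le> real k / N \<Longrightarrow> s k x = 0"
        and s_one: "(real k + 1) / N < f x \<Longrightarrow> s k x = 1" and s_nonneg: "0 \<le> s k x" for k x
        using N by (auto simp: s_def min_def field_simps)
      have As: "A k \<in> sets M" for k unfolding A_def by (rule A[OF f])
      have f_eq: "f x = (\<Sum>k<N. (1 / real N) * s k x)" if "x \<in> \<Omega>" for x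
      proof -
        have "(\<Sum>k<N. (1 / real N) * s k x) = (\<Sum>k<N. min (f x) (real (Suc k) / N) - min (f x) (real k / N))"
          using N by (intro sum.cong) (auto simp: s_def add.commute)
        also have "\<dots> = min (f x) (real N / N) - min (f x) (real 0 / N)"
          by (rule sum_lessThan_telescope)
        also have "\<dots> = f x" using N f01[OF that] by simp
        finally show ?thesis by simp
      qed
      have IA: "I (s k) \<le> measure M (A k)" for k
      proof -
        have "ennreal (I (s k)) \<le> outer (A k)"
          by (rule I_le_outer[OF sL]) (auto simp: s_le s_zero A_def)
        also have "\<dots> = ennreal (measure M (A k))"
          using em[of "A k"] As sets emeasure_eq_measure by metis
        finally show ?thesis by simp
      qed
      have intA: "measure M (A (Suc k)) \<le> integral\<^sup>L M (s k)" for k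
      proof -
        have "measure M (A (Suc k)) = integral\<^sup>L M (indicator (A (Suc k)))"
          using As[of "Suc k"] sets.sets_into_space[OF As[of "Suc k"]] by (simp add: Int_absorb1 Int_absorb2)
        also have "\<dots> \<le> integral\<^sup>L M (s k)"
        proof (rule integral_mono)
          show "integrable M (indicator (A (Suc k)) :: 'a \<Rightarrow> real)"
            using As by (simp add: integrable_indicator_iff emeasure_eq_measure)
          show "indicator (A (Suc k)) x \<le> s k x" for x
            by (auto simp: indicator_def A_def s_nonneg s_one add.commute)
        qed (rule int[OF sL])
        finally show ?thesis .
      qed
      have "I f = I (\<lambda>x. \<Sum>k<N. (1 / real N) * s k x)"
        by (intro antisym I_mono f sum_L scale_L sL) (simp_all add: f_eq)
      also have "\<dots> = (\<Sum>k<N. (1 / real N) * I (s k))"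
        by (simp only: I_sum[OF scale_L[OF sL]] I_scale[OF sL])
      finally have 1: "I f = (\<Sum>k<N. (1 / real N) * I (s k))" .
      have "integral\<^sup>L M f = integral\<^sup>L M (\<lambda>x. \<Sum>k<N. (1 / real N) * s k x)"
        by (rule Bochner_Integration.integral_cong) (simp_all add: space f_eq)
      also have "\<dots> = (\<Sum>k<N. (1 / real N) * integral\<^sup>L M (s k))"
        using int[OF sL] by (simp add: Bochner_Integration.integral_sum)
      finally have "I f - integral\<^sup>L M f = (\<Sum>k<N. (1 / real N) * (I (s k) - integral\<^sup>L M (s k)))"
        by (simp add: 1 sum_subtractf right_diff_distrib)
      also have "\<dots> \<le> (\<Sum>k<N. (1 / real N) * (measure M (A k) - measure M (A (Suc k))))"
        using IA intA N by (intro sum_mono mult_left_mono diff_mono) auto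
      also have "\<dots> = (1 / real N) * (measure M (A 0) - measure M (A N))"
        by (simp only: sum_distrib_left[symmetric] sum_lessThan_telescope'[of "\<lambda>k. measure M (A k)"])
      also have "\<dots> \<le> (1 / real N) * measure M \<Omega>"
      proof (rule mult_left_mono)
        show "measure M (A 0) - measure M (A N) \<le> measure M \<Omega>"
          using bounded_measure[of "A 0"] measure_nonneg[of M "A N"] unfolding space by linarith
      qed simp
      finally show ?thesis by (simp add: N_def)
    qed
    moreover have "(\<lambda>K. measure M \<Omega> / real (Suc K)) \<longlonglongrightarrow> 0"
      by (rule LIMSEQ_Suc[OF lim_const_over_n])
    ultimately have "I f - integral\<^sup>L M f \<le> 0"
      by (intro LIMSEQ_le_const) auto
    then show ?thesis by simp
  qed
  have le: "I f \<le> integral\<^sup>L M f" if f: "f \<in> L" for f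
  proof -
    obtain B0 where B0: "\<forall>x\<in>\<Omega>. \<bar>f x\<bar> \<le> B0" using bounded_L[OF f] by blast
    \<comment> \<open>The maximum with 1 makes \<open>B\<close> positive, so that dividing by
      \<open>2 * B\<close> is legitimate.\<close>
    define B where "B = max B0 1"
    have B: "\<bar>f x\<bar> \<le> B" if "x \<in> \<Omega>" for x using B0 that by (auto simp: B_def intro: le_max_iff_disj[THEN iffD2])
    have B_pos: "0 < B" by (simp add: B_def)
    have gL: "(\<lambda>x. f x + B) \<in> L" by (intro add_L f const_L)
    have "I (\<lambda>x. (1 / (2 * B)) * (f x + B)) \<le> (\<integral>x. (1 / (2 * B)) * (f x + B) \<partial>M)"
    proof (rule unit[OF scale_L[OF gL]])
      fix x assume "x \<in> \<Omega>"
      then show "0 \<le> (1 / (2 * B)) * (f x + B) \<and> (1 / (2 * B)) * (f x + B) \<le> 1"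
        using B[of x] B_pos by (auto simp: field_simps abs_le_iff)
    qed
    then have "(1 / (2 * B)) * I (\<lambda>x. f x + B) \<le> (1 / (2 * B)) * (\<integral>x. f x + B \<partial>M)"
      by (simp only: I_scale[OF gL] integral_mult_right_zero)
    then have "I (\<lambda>x. f x + B) \<le> (\<integral>x. f x + B \<partial>M)" using B_pos by (simp add: divide_le_cancel)
    moreover have "I (\<lambda>x. f x + B) = I f + B * I (\<lambda>x. 1)"
      using I_add[OF f const_L[of B]] I_scale[OF one_L, of B] by simp
    moreover have "(\<integral>x. f x + B \<partial>M) = integral\<^sup>L M f + B * measure M \<Omega>"
      using int[OF f] by (simp add: space)
    ultimately show ?thesis by (simp add: I1)
  qed
  have "integral\<^sup>L M f = I f" if f: "f \<in> L" for f
    using le[OF f] le[OF scale_L[OF f, of "-1"]] I_scale[OF f, of "-1"] by simp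
  with space fin I1 meas show ?thesis by (rule that)
qed

end

section \<open>Functionals on \<open>C(X,E)\<close> as measures\<close>

text \<open>The functionals are plain functions because the topology of a function type is that of
  pointwise convergence, which on this set is the weak* topology.\<close>

definition dual_ball :: "('e::real_normed_vector \<Rightarrow> real) set" where
  "dual_ball = {\<phi>. linear \<phi> \<and> (\<forall>e. \<bar>\<phi> e\<bar> \<le> norm e)}"

lemma dual_ball_linear: "\<phi> \<in> dual_ball \<Longrightarrow> linear \<phi>"
  and dual_ball_le: "\<phi> \<in> dual_ball \<Longrightarrow> \<bar>\<phi> e\<bar> \<le> norm e"
  by (auto simp: dual_ball_def)

text \<open>Banach-Alaoglu: linearity is a family of equations between continuous evaluations, hence
  cuts a closed set out of a product of compact intervals.\<close>

lemma compact_dual_ball: "compact (dual_ball :: ('e::real_normed_vector \<Rightarrow> real) set)"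
proof -
  let ?P = "PiE UNIV (\<lambda>e::'e. {- norm e..norm e})"
  have P: "compact ?P"
    using compactin_PiE[of "\<lambda>_::'e. euclidean :: real topology" UNIV "\<lambda>e. {- norm e..norm e}"]
    by (simp add: euclidean_product_topology)
  have ev: "continuous_on UNIV (\<lambda>\<phi> :: 'e \<Rightarrow> real. \<phi> e)" for e
    by simp
  have eq: "dual_ball = ?P \<inter> ((\<Inter>a b. {\<phi>. \<phi> (a + b) = \<phi> a + \<phi> b}) \<inter> (\<Inter>r a. {\<phi>. \<phi> (r *\<^sub>R a) = r * \<phi> a}))"
    by (auto simp: dual_ball_def linear_iff PiE_def abs_le_iff minus_le_iff)
  have cl: "closed ((\<Inter>a b. {\<phi> :: 'e \<Rightarrow> real. \<phi> (a + b) = \<phi> a + \<phi> b}) \<inter> (\<Inter>r a. {\<phi>. \<phi> (r *\<^sub>R a) = r * \<phi> a}))"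
    by (intro closed_Int closed_INT ballI closed_Collect_eq continuous_on_add continuous_on_mult
        continuous_on_const ev)
  show ?thesis unfolding eq by (rule compact_Int_closed[OF P cl])
qed

text \<open>Hahn-Banach below the norm, with the ray through \<open>(e, norm e)\<close> as the cone
  of prescribed lower bounds.\<close>

lemma dual_ball_norming:
  fixes e :: "'e::real_normed_vector"
  obtains \<phi> where "\<phi> \<in> dual_ball" "\<phi> e = norm e"
proof -
  interpret real_subspace "scaleR :: real \<Rightarrow> 'e \<Rightarrow> 'e" UNIV
    by unfold_locales (simp_all add: algebra_simps module.subspace_UNIV[OF real_vector.module_axioms])
  define D where "D = {(t *\<^sub>R e, t * norm e) |t. 0 \<le> t}"
  have p: "sublinear_on (scaleR :: real \<Rightarrow> 'e \<Rightarrow> 'e) UNIV norm"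
    by (auto simp: sublinear_on_def norm_triangle_ineq)
  obtain \<phi> where le: "\<And>x. \<phi> x \<le> norm x" and add: "\<And>x y. \<phi> (x + y) = \<phi> x + \<phi> y"
    and scale: "\<And>r x. \<phi> (r *\<^sub>R x) = r * \<phi> x" and D: "\<And>w c. (w, c) \<in> D \<Longrightarrow> c \<le> \<phi> w"
  proof (rule hahn_banach_cone[OF p, of D])
    show "(w + v, c + d) \<in> D" if "(w, c) \<in> D" "(v, d) \<in> D" for w c v d
    proof -
      from that obtain s t where "w = s *\<^sub>R e" "c = s * norm e" "v = t *\<^sub>R e" "d = t * norm e" "0 \<le> s" "0 \<le> t"
        by (auto simp: D_def)
      then show ?thesis unfolding D_def
        by (auto intro!: exI[of _ "s + t"] simp: algebra_simps)
    qed
    show "(r *\<^sub>R w, r * c) \<in> D" if "0 < r" "(w, c) \<in> D" for r w c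
    proof -
      from that obtain t where "w = t *\<^sub>R e" "c = t * norm e" "0 \<le> t" by (auto simp: D_def)
      then show ?thesis using that unfolding D_def by (auto intro!: exI[of _ "r * t"])
    qed
    show "(0, 0) \<in> D" unfolding D_def by (auto intro!: exI[of _ 0])
  qed (auto simp: D_def)
  have lin: "linear \<phi>" by (rule linearI) (auto simp: add scale)
  have "\<bar>\<phi> x\<bar> \<le> norm x" for x
    using le[of x] le[of "- x"] linear_neg[OF lin, of x] by auto
  then have "\<phi> \<in> dual_ball" using lin by (simp add: dual_ball_def)
  moreover have "norm e \<le> \<phi> e" by (rule D) (auto simp: D_def intro: exI[of _ 1])
  ultimately show ?thesis using le[of e] by (intro that) auto
qed

text \<open>Joint continuity rests on the equicontinuity of the ball: \<open>\<phi> (f x)\<close> is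
  \<open>\<phi> (f x0)\<close>, continuous in \<phi>, plus \<open>\<phi> (f x - f x0)\<close>, which
  is at most \<open>norm (f x - f x0)\<close> whatever \<phi> is.\<close>

lemma continuous_on_pairing:
  fixes f :: "'x::topological_space \<Rightarrow> 'e::real_normed_vector"
  assumes f: "continuous_on UNIV f"
  shows "continuous_on (UNIV \<times> dual_ball) (\<lambda>(x, \<phi>). \<phi> (f x))"
  unfolding continuous_on_def
proof
  fix z0 :: "'x \<times> ('e \<Rightarrow> real)" assume z0: "z0 \<in> UNIV \<times> dual_ball"
  obtain x0 \<phi>0 where z0_eq: "z0 = (x0, \<phi>0)" by (cases z0)
  let ?F = "at z0 within UNIV \<times> dual_ball"
  have 1: "((\<lambda>z. snd z (f x0)) \<longlongrightarrow> \<phi>0 (f x0)) ?F"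
  proof -
    have "continuous_on UNIV (\<lambda>z :: 'x \<times> ('e \<Rightarrow> real). snd z (f x0))"
      by (rule continuous_on_compose2[OF continuous_on_product_coordinates continuous_on_snd[OF continuous_on_id]]) simp
    then have "((\<lambda>z. snd z (f x0)) \<longlongrightarrow> snd z0 (f x0)) (at z0)"
      unfolding continuous_on_def by blast
    then show ?thesis by (auto simp: z0_eq intro: tendsto_within_subset)
  qed
  have "continuous_on UNIV (\<lambda>z :: 'x \<times> ('e \<Rightarrow> real). f (fst z))"
    by (intro continuous_on_compose2[OF f] continuous_intros) auto
  then have "((\<lambda>z. f (fst z)) \<longlongrightarrow> f x0) (at z0)"
    by (auto simp: continuous_on_def z0_eq)
  then have "((\<lambda>z. f (fst z)) \<longlongrightarrow> f x0) ?F"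
    by (rule tendsto_within_subset) simp
  then have 2: "((\<lambda>z. norm (f (fst z) - f x0)) \<longlongrightarrow> 0) ?F"
    by (intro tendsto_norm_zero) (simp add: LIM_zero_iff)
  have 3: "((\<lambda>z. snd z (f (fst z) - f x0)) \<longlongrightarrow> 0) ?F"
  proof (rule Lim_null_comparison[OF _ 2])
    show "\<forall>\<^sub>F z in ?F. norm (snd z (f (fst z) - f x0)) \<le> norm (f (fst z) - f x0)"
      unfolding eventually_at_filter by (rule always_eventually) (auto intro: dual_ball_le)
  qed
  have "((\<lambda>z. snd z (f x0) + snd z (f (fst z) - f x0)) \<longlongrightarrow> \<phi>0 (f x0) + 0) ?F"
    by (intro tendsto_add 1 3)
  then have "((\<lambda>(x, \<phi>). \<phi> (f x)) \<longlongrightarrow> \<phi>0 (f x0) + 0) ?F"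
  proof (rule Lim_transform_eventually)
    show "\<forall>\<^sub>F z in ?F. snd z (f x0) + snd z (f (fst z) - f x0) = (case z of (x, \<phi>) \<Rightarrow> \<phi> (f x))"
      unfolding eventually_at_filter
      by (rule always_eventually) (auto simp: linear_diff[OF dual_ball_linear])
  qed
  then show "((\<lambda>(x, \<phi>). \<phi> (f x)) \<longlongrightarrow> (case z0 of (x, \<phi>) \<Rightarrow> \<phi> (f x))) ?F"
    by (simp add: z0_eq)
qed

text \<open>Dini's theorem. An upper bound says everything, because a sequence decreasing to 0 is
  nonnegative.\<close>

lemma dini_decreasing_to_0:
  fixes u :: "nat \<Rightarrow> 'a::topological_space \<Rightarrow> real"
  assumes K: "compact K" and cont: "\<And>n. continuous_on K (u n)"
    and dec: "\<And>x. x \<in> K \<Longrightarrow> decseq (\<lambda>n. u n x)"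
    and lim: "\<And>x. x \<in> K \<Longrightarrow> (\<lambda>n. u n x) \<longlonglongrightarrow> 0" and e: "0 < e"
  shows "\<exists>N. \<forall>n\<ge>N. \<forall>x\<in>K. u n x < e"
proof -
  have "\<exists>W. open W \<and> W \<inter> K = u n -` {..<e} \<inter> K" for n
    using cont[of n] continuous_on_open_invariant open_lessThan by metis
  then obtain W where W: "\<And>n. open (W n)" "\<And>n. W n \<inter> K = u n -` {..<e} \<inter> K" by metis
  have cover: "K \<subseteq> (\<Union>n\<in>UNIV. W n)"
  proof
    fix x assume x: "x \<in> K"
    have "eventually (\<lambda>n. u n x < e) sequentially" using lim[OF x] e by (rule order_tendstoD)
    then obtain n where "u n x < e" by (auto simp: eventually_sequentially)
    then have "x \<in> W n \<inter> K" using x by (simp add: W(2))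
    then show "x \<in> (\<Union>n\<in>UNIV. W n)" by blast
  qed
  obtain S where S: "finite S" "K \<subseteq> (\<Union>n\<in>S. W n)"
    by (rule compactE_image[OF K W(1) cover])
  show ?thesis
  proof (intro exI allI impI ballI)
    \<comment> \<open>Inserting 0 keeps \<open>Max\<close> meaningful when the subcover is
      empty.\<close>
    fix n x assume n: "Max (insert 0 S) \<le> n" and x: "x \<in> K"
    then obtain m where m: "m \<in> S" "x \<in> W m" using S by blast
    then have "m \<le> n" using n S(1) by auto
    moreover have "u m x < e" using m x W(2)[of m] by blast
    ultimately show "u n x < e" using decseqD[OF dec[OF x]] by (meson le_less_trans)
  qed
qed

lemma functional_as_measure:
  fixes l :: "('x::topological_space \<Rightarrow>\<^sub>C 'e::real_normed_vector) \<Rightarrow> real"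
  assumes compact: "compact (UNIV :: 'x set)" and l: "linear l"
    and C: "0 \<le> C" and l_le: "\<And>f. \<bar>l f\<bar> \<le> C * norm f"
  obtains M where "space M = UNIV \<times> dual_ball" "finite_measure M" "measure M (space M) \<le> C"
    and "\<And>f. (\<lambda>(x, \<phi>). \<phi> (apply_bcontfun f x)) \<in> borel_measurable M"
    and "\<And>f. (\<integral>(x, \<phi>). \<phi> (apply_bcontfun f x) \<partial>M) = l f"
proof -
  define K :: "('x \<times> ('e \<Rightarrow> real)) set" where "K = UNIV \<times> dual_ball"
  have K: "compact K" unfolding K_def by (intro compact_Times compact compact_dual_ball)
  have "(\<lambda>_. 0) \<in> dual_ball" by (auto simp: dual_ball_def linear_iff)
  then have K_ne: "K \<noteq> {}" by (auto simp: K_def)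
  define V :: "('x \<times> ('e \<Rightarrow> real) \<Rightarrow> real) set" where "V = {G. continuous_on K G}"
  define sc :: "real \<Rightarrow> ('x \<times> ('e \<Rightarrow> real) \<Rightarrow> real) \<Rightarrow> 'x \<times> ('e \<Rightarrow> real) \<Rightarrow> real"
    where "sc r G = (\<lambda>z. r * G z)" for r G
  interpret vector_space sc
    by standard (auto simp: sc_def algebra_simps)
  interpret real_subspace sc V
    by standard (auto simp: subspace_def V_def sc_def plus_fun_def zero_fun_def intro!: continuous_intros)
  define F where "F f = (\<lambda>(x, \<phi>). \<phi> (apply_bcontfun f x) :: real)" for f :: "'x \<Rightarrow>\<^sub>C 'e"
  have F_V: "F f \<in> V" for f
    unfolding V_def F_def K_def by (simp add: continuous_on_pairing)
  define p where "p G = C * (SUP z\<in>K. G z)" for G :: "'x \<times> ('e \<Rightarrow> real) \<Rightarrow> real"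
  have bdd: "bounded (G ` K)" if "G \<in> V" for G
    using that K unfolding V_def by (intro compact_imp_bounded compact_continuous_image) auto
  have upper: "G z \<le> (SUP z\<in>K. G z)" if "G \<in> V" "z \<in> K" for G z
    using bdd[OF that(1)] that(2) by (intro cSUP_upper bounded_imp_bdd_above)
  have least: "p G \<le> C * b" if "\<And>z. z \<in> K \<Longrightarrow> G z \<le> b" for G b
    unfolding p_def using C K_ne that by (intro mult_left_mono cSUP_least)
  have p: "sublinear_on sc V p"
    unfolding sublinear_on_def
  proof (intro conjI ballI allI impI)
    fix G H assume GH: "G \<in> V" "H \<in> V"
    have "p (G + H) \<le> C * ((SUP z\<in>K. G z) + (SUP z\<in>K. H z))"
      by (rule least) (auto intro!: add_mono upper GH)
    then show "p (G + H) \<le> p G + p H" by (simp add: p_def algebra_simps)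
  next
    fix r :: real and G assume r: "0 < r" and G: "G \<in> V"
    have "p (sc r G) \<le> C * (r * (SUP z\<in>K. G z))"
      using r by (intro least) (auto simp: sc_def intro!: mult_left_mono upper G)
    then show "p (sc r G) \<le> r * p G" by (simp add: p_def mult.left_commute)
  qed
  \<comment> \<open>Agreement with \<open>F f\<close> is demanded on \<open>K\<close> only: where
    \<phi> is not linear, \<open>F (f + g)\<close> differs from \<open>F f + F g\<close>.\<close>
  define D where "D = {(w, c). w \<in> V \<and> (\<exists>f. (\<forall>z\<in>K. w z = F f z) \<and> c = l f)}"
  have D_le: "w \<in> V \<and> c \<le> p w" if "(w, c) \<in> D" for w c
  proof -
    from that obtain f where w: "w \<in> V" and f: "\<And>z. z \<in> K \<Longrightarrow> w z = F f z" and c: "c = l f"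
      by (auto simp: D_def)
    \<comment> \<open>Each \<open>norm (f x)\<close> is a value of \<open>F f\<close>, attained at a
      norming functional, so the one-sided supremum already controls the norm.\<close>
    have "norm f \<le> (SUP z\<in>K. w z)"
    proof (rule norm_bound)
      fix x
      obtain \<phi> where \<phi>: "\<phi> \<in> dual_ball" "\<phi> (f x) = norm (f x)" by (rule dual_ball_norming)
      then have "(x, \<phi>) \<in> K" by (simp add: K_def)
      from upper[OF w this] f[OF this] \<phi> show "norm (f x) \<le> (SUP z\<in>K. w z)"
        by (simp add: F_def)
    qed
    then have "C * norm f \<le> p w" unfolding p_def using C by (rule mult_left_mono)
    with l_le[of f] w c show ?thesis by auto
  qed
  have D_add: "(w + v, c + d) \<in> D" if wv: "(w, c) \<in> D" "(v, d) \<in> D" for w c v d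
  proof -
    from wv obtain f g where "\<forall>z\<in>K. w z = F f z" "c = l f" "\<forall>z\<in>K. v z = F g z" "d = l g"
      by (auto simp: D_def)
    then have "\<forall>z\<in>K. (w + v) z = F (f + g) z" "c + d = l (f + g)"
      by (auto simp: K_def F_def linear_add[OF l] linear_add[OF dual_ball_linear])
    moreover have "w + v \<in> V" using wv by (auto simp: D_def intro: V_closed)
    ultimately show ?thesis by (auto simp: D_def)
  qed
  have D_scale: "(sc r w, r * c) \<in> D" if w: "(w, c) \<in> D" for r w c
  proof -
    from w obtain f where "\<forall>z\<in>K. w z = F f z" "c = l f"
      by (auto simp: D_def)
    then have "\<forall>z\<in>K. sc r w z = F (r *\<^sub>R f) z" "r * c = l (r *\<^sub>R f)"
      by (auto simp: K_def F_def sc_def linear_scale[OF l] linear_scale[OF dual_ball_linear])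
    moreover have "sc r w \<in> V" using w by (auto simp: D_def intro: V_closed)
    ultimately show ?thesis by (auto simp: D_def)
  qed
  have D_F: "(F f, l f) \<in> D" for f using F_V by (auto simp: D_def)
  have D_0: "(0, 0) \<in> D"
    using D_scale[OF D_F, of 0] by (simp add: sc_def zero_fun_def)
  obtain J where J_le: "\<And>G. G \<in> V \<Longrightarrow> J G \<le> p G"
    and J_add: "\<And>G H. G \<in> V \<Longrightarrow> H \<in> V \<Longrightarrow> J (G + H) = J G + J H"
    and J_scale: "\<And>r G. G \<in> V \<Longrightarrow> J (sc r G) = r * J G"
    and J_D: "\<And>w c. (w, c) \<in> D \<Longrightarrow> c \<le> J w"
    by (rule hahn_banach_cone[OF p D_le D_0 D_add D_scale]) auto
  \<comment> \<open>\<open>D\<close> is closed under multiplication by -1 as well, so the lower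
    bounds at \<open>F f\<close> and at its negative fix the value.\<close>
  have J_F: "J (F f) = l f" for f
    using J_D[OF D_F] J_D[OF D_scale[OF D_F, of "-1"]] J_scale[OF F_V, of "-1"]
    by (simp add: antisym)
  have J_bound: "J G \<le> C * b" if "G \<in> V" "\<And>z. z \<in> K \<Longrightarrow> G z \<le> b" for G b
    using J_le[OF that(1)] least[OF that(2)] by (rule order_trans)
  \<comment> \<open>Positivity comes from the majorant: \<open>- G\<close> is at most 0, hence
    \<open>J (- G) \<le> C * 0\<close>.\<close>
  have J_nonneg: "0 \<le> J G" if "G \<in> V" "\<And>z. z \<in> K \<Longrightarrow> 0 \<le> G z" for G
    using J_bound[of "sc (-1) G" 0] J_scale[OF that(1), of "-1"] V_closed(3)[OF that(1), of "-1"] that(2)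
    by (simp add: sc_def)
  interpret daniell_functional K V J
  proof
    show "(\<lambda>n. J (u n)) \<longlonglongrightarrow> 0"
      if u: "\<And>n. u n \<in> V" and dec: "\<And>z. z \<in> K \<Longrightarrow> decseq (\<lambda>n. u n z)"
        and lim: "\<And>z. z \<in> K \<Longrightarrow> (\<lambda>n. u n z) \<longlonglongrightarrow> 0" for u
    proof (rule LIMSEQ_I)
      fix r :: real assume r: "0 < r"
      \<comment> \<open>The denominator is \<open>C + 1\<close> because \<open>C\<close> may be
        0.\<close>
      define e where "e = r / (C + 1)"
      have e: "0 < e" "C * e < r" using r C by (auto simp: e_def field_simps)
      have "continuous_on K (u n)" for n using u[of n] by (simp add: V_def)
      from dini_decreasing_to_0[OF K this dec lim e(1)]
      obtain N where N: "\<And>n z. N \<le> n \<Longrightarrow> z \<in> K \<Longrightarrow> u n z < e" by blast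
      have "norm (J (u n) - 0) < r" if n: "N \<le> n" for n
      proof -
        have "0 \<le> J (u n)" using u lim dec by (intro J_nonneg) (auto intro: decseq_ge)
        moreover have "J (u n) \<le> C * e" by (rule J_bound[OF u]) (use N n in \<open>auto intro: less_imp_le\<close>)
        ultimately show ?thesis using e by simp
      qed
      then show "\<exists>no. \<forall>n\<ge>no. norm (J (u n) - 0) < r" by blast
    qed
    show "\<exists>B. \<forall>z\<in>K. \<bar>G z\<bar> \<le> B" if "G \<in> V" for G
      using bdd[OF that] by (auto simp: bounded_iff)
    show "J (\<lambda>z. G z + H z) = J G + J H" if "G \<in> V" "H \<in> V" for G H
      using J_add[OF that] by (simp add: plus_fun_def)
    show "J (\<lambda>z. c * G z) = c * J G" if "G \<in> V" for G c
      using J_scale[OF that] by (simp add: sc_def)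
  qed (auto simp: V_def intro!: continuous_intros continuous_on_min J_nonneg)
  obtain M where M: "space M = K" "finite_measure M" "measure M K = J (\<lambda>z. 1)"
    and "\<And>G. G \<in> V \<Longrightarrow> G \<in> borel_measurable M"
    and "\<And>G. G \<in> V \<Longrightarrow> integral\<^sup>L M G = J G"
    by (rule daniell_stone) auto
  then have "F f \<in> borel_measurable M" "integral\<^sup>L M (F f) = l f" for f
    using F_V J_F by auto
  moreover have "measure M (space M) \<le> C"
    using J_bound[OF one_L, of 1] M by simp
  ultimately show ?thesis
    using M by (intro that[of M]) (auto simp: K_def F_def)
qed

section \<open>Real parts of functionals\<close>

definition scalar_emb :: "'k::real_or_complex \<Rightarrow> complex" where
  "scalar_emb = (SOME h. (\<forall>x y. h (x + y) = h x + h y) \<and> (\<forall>x y. h (x * y) = h x * h y) \<and>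
       (\<forall>x. norm (h x) = norm x) \<and> (range h = \<real> \<or> range h = UNIV))"

lemma scalar_emb:
  fixes x y :: "'k::real_or_complex"
  shows scalar_emb_add: "scalar_emb (x + y) = scalar_emb x + scalar_emb y"
    and scalar_emb_mult: "scalar_emb (x * y) = scalar_emb x * scalar_emb y"
    and norm_scalar_emb: "norm (scalar_emb x) = norm x"
    and range_scalar_emb: "range (scalar_emb :: 'k \<Rightarrow> complex) = \<real> \<or> range (scalar_emb :: 'k \<Rightarrow> complex) = UNIV"
  using someI_ex[OF real_or_complex_iso[where 'a = 'k]] unfolding scalar_emb_def[symmetric] by blast+

lemma scalar_emb_diff: "scalar_emb (x - y) = scalar_emb x - scalar_emb y"
  using scalar_emb_add[of "x - y" y] by simp

lemma scalar_emb_inject: "scalar_emb x = scalar_emb y \<longleftrightarrow> x = y"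
  using norm_scalar_emb[of "x - y"] by (auto simp: scalar_emb_diff)

lemma scalar_emb_1: "scalar_emb 1 = 1"
  using scalar_emb_mult[of 1 "1::'a"] norm_scalar_emb[of "1::'a"] by auto

text \<open>A complex number at distance \<open>\<bar>r\<bar>\<close> from 0 and \<open>\<bar>r - 1\<bar>\<close> from 1 equals the real number \<open>r\<close>.\<close>

lemma scalar_emb_of_real: "scalar_emb (of_real r) = of_real r"
proof -
  let ?z = "scalar_emb (of_real r :: 'a)"
  have "norm ?z = \<bar>r\<bar>" by (simp add: norm_scalar_emb)
  then have 1: "(Re ?z)\<^sup>2 + (Im ?z)\<^sup>2 = r\<^sup>2" by (metis cmod_power2 power2_abs)
  have "norm (?z - 1) = norm (of_real r - (1 :: 'a))"
    by (metis norm_scalar_emb scalar_emb_1 scalar_emb_diff)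
  also have "\<dots> = \<bar>r - 1\<bar>" by (metis norm_of_real of_real_1 of_real_diff)
  finally have "(Re (?z - 1))\<^sup>2 + (Im (?z - 1))\<^sup>2 = (r - 1)\<^sup>2" by (metis cmod_power2 power2_abs)
  then have "Re ?z = r" using 1 by (simp add: power2_eq_square algebra_simps)
  moreover from this have "Im ?z = 0" using 1 by simp
  ultimately show ?thesis by (simp add: complex_eq_iff)
qed

definition scalar_re :: "'k::real_or_complex \<Rightarrow> real" where
  "scalar_re c = Re (scalar_emb c)"

lemma scalar_re_le: "\<bar>scalar_re c\<bar> \<le> norm c"
  using abs_Re_le_cmod[of "scalar_emb c"] by (simp add: scalar_re_def norm_scalar_emb)

lemma bounded_linear_scalar_re: "bounded_linear scalar_re"
proof (rule bounded_linear_intro[where K = 1])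
  show "scalar_re (r *\<^sub>R x) = r *\<^sub>R scalar_re x" for r and x :: 'a
    by (simp add: scalar_re_def scaleR_conv_of_real scalar_emb_mult scalar_emb_of_real)
qed (auto simp: scalar_re_def scalar_emb_add scalar_re_le[unfolded scalar_re_def])

lemmas scalar_re_linear =
  linear_add[OF bounded_linear.linear[OF bounded_linear_scalar_re]]
  linear_diff[OF bounded_linear.linear[OF bounded_linear_scalar_re]]
  linear_scale[OF bounded_linear.linear[OF bounded_linear_scalar_re]]

text \<open>The witness is the conjugate of \<open>k\<close> divided by its norm. It lies in the
  range of the embedding also when that range is the real line, since there conjugation is the
  identity.\<close>

lemma scalar_re_norming:
  fixes k :: "'k::real_or_complex"
  obtains c where "norm c = 1" "scalar_re (c * k) = norm k"
proof (cases "k = 0")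
  case True
  then show ?thesis
    by (intro that[of 1]) (use scalar_re_le[of "0::'k"] in auto)
next
  case False
  let ?w = "cnj (scalar_emb k) / of_real (norm k)"
  have "?w \<in> range (scalar_emb :: 'k \<Rightarrow> complex)"
  proof (cases "range (scalar_emb :: 'k \<Rightarrow> complex) = UNIV")
    case False
    then have R: "range (scalar_emb :: 'k \<Rightarrow> complex) = \<real>" using range_scalar_emb by blast
    then have "scalar_emb k \<in> \<real>" by blast
    then have "cnj (scalar_emb k) = scalar_emb k" by (rule Reals_cnj_iff[THEN iffD1])
    then show ?thesis using R \<open>scalar_emb k \<in> \<real>\<close> by simp
  qed simp
  then obtain c :: 'k where c: "scalar_emb c = ?w" by auto
  have "norm c = norm ?w" by (metis c norm_scalar_emb)
  also have "\<dots> = 1" using False by (simp add: norm_divide norm_scalar_emb)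
  finally have "norm c = 1" .
  moreover have "scalar_emb (c * k) = of_real (norm k)"
    using False by (simp add: scalar_emb_mult c mult.commute[of "cnj _"] complex_norm_square[symmetric] norm_scalar_emb power2_eq_square)
  then have "scalar_re (c * k) = norm k" by (simp add: scalar_re_def)
  ultimately show ?thesis by (rule that)
qed

lemma scalar_re_eqI:
  assumes "\<And>c. scalar_re (c * a) = scalar_re (c * b)" shows "a = b"
proof -
  obtain c where "scalar_re (c * (a - b)) = norm (a - b)" by (rule scalar_re_norming)
  then show ?thesis using assms[of c] by (simp add: right_diff_distrib scalar_re_linear)
qed

text \<open>Over the complex numbers k = Re k - i Re (i k); in the real case \<open>H\<close> reads
  its first component only. Measurability and limits can thus be checked on real parts.\<close>

lemma scalar_from_re:
  "\<exists>(i :: 'k::real_or_complex) H. continuous_on UNIV H \<and> (\<forall>k. k = H (scalar_re k, scalar_re (i * k)))"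
proof (cases "range (scalar_emb :: 'k \<Rightarrow> complex) = UNIV")
  case True
  then obtain i :: 'k where i: "scalar_emb i = \<i>" by (metis UNIV_I imageE)
  define H where "H = (\<lambda>(a, b). of_real a - i * of_real b :: 'k)"
  have "continuous_on UNIV H"
    unfolding H_def split_def by (intro continuous_intros)
  moreover have "k = H (scalar_re k, scalar_re (i * k))" for k
    by (rule scalar_emb_inject[THEN iffD1])
      (simp add: H_def scalar_re_def scalar_emb_add scalar_emb_diff scalar_emb_mult scalar_emb_of_real i complex_eq_iff)
  ultimately show ?thesis by blast
next
  case False
  then have R: "range (scalar_emb :: 'k \<Rightarrow> complex) = \<real>" using range_scalar_emb by blast
  have "k = of_real (scalar_re k)" for k :: 'k
  proof -
    have "scalar_emb k \<in> \<real>" using R by blast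
    then have "scalar_emb k = scalar_emb (of_real (scalar_re k) :: 'k)"
      by (simp add: scalar_emb_of_real scalar_re_def)
    then show ?thesis by (rule scalar_emb_inject[THEN iffD1])
  qed
  moreover have "continuous_on UNIV (\<lambda>z. of_real (fst z) :: 'k)" by (intro continuous_intros)
  ultimately show ?thesis by (intro exI[of _ 1] exI[of _ "\<lambda>z. of_real (fst z)"]) simp
qed

lemma scalar_re_tendstoI:
  fixes u :: "'a \<Rightarrow> 'k::real_or_complex"
  assumes "\<And>c. ((\<lambda>n. scalar_re (c * u n)) \<longlongrightarrow> scalar_re (c * a)) F"
  shows "(u \<longlongrightarrow> a) F"
proof -
  obtain i :: 'k and H where H: "continuous_on UNIV H" and eq: "\<And>k. H (scalar_re k, scalar_re (i * k)) = k"
    using scalar_from_re[where 'k = 'k] by metis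
  have "((\<lambda>n. (scalar_re (1 * u n), scalar_re (i * u n))) \<longlongrightarrow> (scalar_re (1 * a), scalar_re (i * a))) F"
    by (intro tendsto_Pair assms)
  then have "((\<lambda>n. H (scalar_re (u n), scalar_re (i * u n))) \<longlongrightarrow> H (scalar_re a, scalar_re (i * a))) F"
    by (intro continuous_on_tendsto_compose[OF H]) auto
  then show ?thesis by (simp add: eq)
qed

text \<open>Over the complex numbers the representing scalar is g(1) - i g(i), in the real case
  g(1). This is the tool that turns a real functional into a scalar-linear one.\<close>

lemma scalar_functional_representation:
  fixes g :: "'k::real_or_complex \<Rightarrow> real"
  assumes g: "linear g"
  shows "\<exists>k. \<forall>c. scalar_re (c * k) = g c"
proof (cases "range (scalar_emb :: 'k \<Rightarrow> complex) = UNIV")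
  case True
  then obtain i :: 'k where i: "scalar_emb i = \<i>" by (metis UNIV_I imageE)
  have "scalar_re (c * (of_real (g 1) - i * of_real (g i))) = g c" for c
  proof -
    let ?a = "Re (scalar_emb c)" and ?b = "Im (scalar_emb c)"
    have "scalar_emb c = scalar_emb (?a *\<^sub>R 1 + ?b *\<^sub>R i)"
      by (simp add: scaleR_conv_of_real scalar_emb_add scalar_emb_mult scalar_emb_of_real i scalar_emb_1 complex_eq_iff)
    then have c: "c = ?a *\<^sub>R 1 + ?b *\<^sub>R i" by (rule scalar_emb_inject[THEN iffD1])
    have "g c = ?a * g 1 + ?b * g i"
      by (subst c) (simp add: linear_add[OF g] linear_scale[OF g])
    then show ?thesis
      by (simp add: scalar_re_def scalar_emb_mult scalar_emb_diff scalar_emb_of_real i)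
  qed
  then show ?thesis by blast
next
  case False
  then have R: "range (scalar_emb :: 'k \<Rightarrow> complex) = \<real>" using range_scalar_emb by blast
  have "scalar_re (c * of_real (g 1)) = g c" for c
  proof -
    have "scalar_emb c \<in> \<real>" using R by blast
    then have "scalar_emb c = scalar_emb (scalar_re c *\<^sub>R 1)"
      by (simp add: scaleR_conv_of_real scalar_emb_mult scalar_emb_of_real scalar_emb_1 scalar_re_def of_real_Re)
    then have c: "c = scalar_re c *\<^sub>R 1" by (rule scalar_emb_inject[THEN iffD1])
    have "g c = scalar_re c * g 1"
      by (subst c) (simp add: linear_scale[OF g] del: scaleR_one)
    then show ?thesis by (simp add: scalar_re_def scalar_emb_mult scalar_emb_of_real)
  qed
  then show ?thesis by blast
qed

section \<open>Scalar-linear functionals and their real parts\<close>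

lemma dual_space_eqI:
  assumes "\<psi>1 \<in> dual_space sm" "\<psi>2 \<in> dual_space sm"
    and "\<And>y. scalar_re (blinfun_apply \<psi>1 y) = scalar_re (blinfun_apply \<psi>2 y)"
  shows "\<psi>1 = \<psi>2"
proof (rule blinfun_eqI, rule scalar_re_eqI)
  \<comment> \<open>Homogeneity moves \<open>c\<close> into the argument, so the real parts at all
    vectors determine the scalar values.\<close>
  show "scalar_re (c * blinfun_apply \<psi>1 y) = scalar_re (c * blinfun_apply \<psi>2 y)" for c y
    using assms(1,2) assms(3)[of "sm c y"] by (simp add: dual_space_def)
qed

context normed_space_over
begin

text \<open>The value at \<open>y\<close> is the scalar that represents the real functional
  \<open>c \<mapsto> \<phi> (c y)\<close>. The bound \<open>C\<close> survives unchanged: for a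
  suitable \<open>c\<close> of norm 1 the norm of that scalar is
  \<open>\<phi> (c y)\<close>.\<close>

lemma dual_space_extension_of_real_part:
  assumes \<phi>: "linear \<phi>" and C: "0 \<le> C" and le: "\<And>y. \<bar>\<phi> y\<bar> \<le> C * norm y"
  shows "\<exists>\<psi>\<in>dual_space sm. (\<forall>y. scalar_re (blinfun_apply \<psi> y) = \<phi> y) \<and> norm \<psi> \<le> C"
proof -
  have lin: "linear (\<lambda>c. \<phi> (sm c y))" for y
  proof (rule linearI)
    show "\<phi> (sm (a + b) y) = \<phi> (sm a y) + \<phi> (sm b y)" for a b
      by (simp add: scale_left_distrib linear_add[OF \<phi>])
    have "sm (r *\<^sub>R a) y = r *\<^sub>R sm a y" for r a
      by (metis scaleR_conv_of_real scale_of_real scale_scale)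
    then show "\<phi> (sm (r *\<^sub>R a) y) = r *\<^sub>R \<phi> (sm a y)" for r a
      by (simp add: linear_scale[OF \<phi>])
  qed
  have ex: "\<exists>k. \<forall>c. scalar_re (c * k) = \<phi> (sm c y)" for y
    by (rule scalar_functional_representation[OF lin])
  define k where "k y = (SOME k. \<forall>c. scalar_re (c * k) = \<phi> (sm c y))" for y
  have k: "scalar_re (c * k y) = \<phi> (sm c y)" for y c
    using someI_ex[OF ex[of y]] unfolding k_def by blast
  have k_scale: "k (sm c y) = c * k y" for c y
    by (rule scalar_re_eqI) (simp add: k mult.assoc[symmetric])
  have k_norm: "norm (k y) \<le> C * norm y" for y
  proof -
    obtain c where c: "norm c = 1" "scalar_re (c * k y) = norm (k y)" by (rule scalar_re_norming)
    then show ?thesis using le[of "sm c y"] by (simp add: k norm_scale)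
  qed
  have bl: "bounded_linear k"
  proof (rule bounded_linear_intro[where K = C])
    show "k (x + y) = k x + k y" for x y
      by (rule scalar_re_eqI)
        (simp add: k scale_right_distrib linear_add[OF \<phi>] distrib_left scalar_re_linear)
    show "k (r *\<^sub>R x) = r *\<^sub>R k x" for r x
      using k_scale[of "of_real r" x] by (simp add: scale_of_real scaleR_conv_of_real)
    show "norm (k x) \<le> norm x * C" for x using k_norm[of x] by (simp add: mult.commute)
  qed
  show ?thesis
  proof (intro bexI[of _ "Blinfun k"] conjI allI)
    show "Blinfun k \<in> dual_space sm"
      by (simp add: dual_space_def bounded_linear_Blinfun_apply[OF bl] k_scale)
    show "scalar_re (blinfun_apply (Blinfun k) y) = \<phi> y" for y
      using k[of 1 y] by (simp add: bounded_linear_Blinfun_apply[OF bl])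
    show "norm (Blinfun k) \<le> C"
      by (rule norm_blinfun_bound[OF C]) (simp add: bounded_linear_Blinfun_apply[OF bl] k_norm)
  qed
qed

end

section \<open>Convergence in the weak and weak* topologies\<close>

lemma limitin_topology_generated_by:
  "limitin (topology_generated_by S) u a F \<longleftrightarrow>
     a \<in> \<Union>S \<and> (\<forall>U\<in>S. a \<in> U \<longrightarrow> eventually (\<lambda>n. u n \<in> U) F)"
proof
  assume "limitin (topology_generated_by S) u a F"
  then show "a \<in> \<Union>S \<and> (\<forall>U\<in>S. a \<in> U \<longrightarrow> eventually (\<lambda>n. u n \<in> U) F)"
    using topology_generated_by_Basis[of _ S] by (auto simp: limitin_def)
next
  assume *: "a \<in> \<Union>S \<and> (\<forall>U\<in>S. a \<in> U \<longrightarrow> eventually (\<lambda>n. u n \<in> U) F)"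
  \<comment> \<open>Eventual membership passes from the subbasis to finite intersections and
    arbitrary unions.\<close>
  have "eventually (\<lambda>n. u n \<in> U) F" if "generate_topology_on S U" "a \<in> U" for U
    using that
  proof (induction rule: generate_topology_on.induct)
    case (UN K)
    then obtain V where "V \<in> K" "eventually (\<lambda>n. u n \<in> V) F" by blast
    then show ?case by (auto elim: eventually_mono)
  qed (use * in \<open>auto simp: eventually_conj_iff\<close>)
  then show "limitin (topology_generated_by S) u a F"
    using * by (auto simp: limitin_def openin_topology_generated_by_iff)
qed

lemma ball_setcompr2: "(\<forall>V\<in>{g y U |y U. P y U}. Q V) \<longleftrightarrow> (\<forall>y U. P y U \<longrightarrow> Q (g y U))"
  by blast

lemma limitin_weak_topology:
  "limitin (weak_topology sm) u a F \<longleftrightarrow>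
     (\<forall>\<psi>\<in>dual_space sm. ((\<lambda>n. blinfun_apply \<psi> (u n)) \<longlongrightarrow> blinfun_apply \<psi> a) F)"
proof -
  \<comment> \<open>The preimage of everything under the zero functional is a subbasic set
    containing all points, so every \<open>a\<close> lies in the topological space.\<close>
  have "0 \<in> dual_space sm" by (simp add: dual_space_def)
  then have "a \<in> \<Union>{blinfun_apply \<psi> -` U |\<psi> U. \<psi> \<in> dual_space sm \<and> open U}"
    by (intro UnionI[of "blinfun_apply 0 -` UNIV"]) (blast intro: open_UNIV, simp)
  then show ?thesis
    unfolding weak_topology_def limitin_topology_generated_by tendsto_def ball_setcompr2 by auto
qed

lemma limitin_weak_star_topology:
  assumes u: "\<And>n. u n \<in> dual_space sm"
  shows "limitin (weak_star_topology sm) u a F \<longleftrightarrow>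
     a \<in> dual_space sm \<and> (\<forall>y. ((\<lambda>n. blinfun_apply (u n) y) \<longlongrightarrow> blinfun_apply a y) F)"
proof -
  have "a \<in> \<Union>{{\<phi> \<in> dual_space sm. blinfun_apply \<phi> y \<in> U} |y U. open U} \<longleftrightarrow> a \<in> dual_space sm"
    using open_UNIV by blast
  then show ?thesis
    unfolding weak_star_topology_def limitin_topology_generated_by tendsto_def ball_setcompr2
    by (auto simp: u)
qed

section \<open>The space \<open>M(X,E)\<close>\<close>

lemma space_baire_algebra [simp]: "space baire_algebra = UNIV"
  by (simp add: baire_algebra_def space_measure_of)

lemma sets_baire_algebra: "sets baire_algebra = sigma_sets UNIV {A. closed A \<and> gdelta A}"
  by (simp add: baire_algebra_def sets_measure_of)

text \<open>The preimage of a closed set is closed, and it is a countable intersection of open sets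
  because the closed set consists of the points at distance 0 from it.\<close>

lemma continuous_imp_baire_measurable:
  fixes g :: "'x::topological_space \<Rightarrow> 'b::metric_space"
  assumes g: "continuous_on UNIV g"
  shows "g \<in> borel_measurable baire_algebra"
proof (rule borel_measurableI)
  fix U :: "'b set" assume U: "open U"
  have "g -` (- U) \<in> sets baire_algebra"
  \<comment> \<open>\<open>U = UNIV\<close> is separate, since the distance to the empty set is 0 by
    convention.\<close>
  proof (cases "U = UNIV")
    case False
    have "closed (g -` (- U))"
      using g U by (intro closed_vimage) auto
    moreover have eq: "g -` (- U) = (\<Inter>n. {x. infdist (g x) (- U) < 1 / real (Suc n)})"
    proof -
      have "y \<in> - U" if "\<And>n. infdist y (- U) < 1 / real (Suc n)" for y
      proof -
        have "infdist y (- U) \<le> 0"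
        proof (rule field_le_epsilon)
          fix e :: real assume "0 < e"
          then obtain n where "1 / real (Suc n) < e" using nat_approx_posE by blast
          then show "infdist y (- U) \<le> 0 + e" using that[of n] by simp
        qed
        then have "infdist y (- U) = 0" using infdist_nonneg[of y "- U"] by simp
        then show ?thesis using U False by (subst in_closed_iff_infdist_zero) auto
      qed
      then show ?thesis by auto
    qed
    have "gdelta (g -` (- U))"
      unfolding eq by (intro gdelta.intros open_Collect_less continuous_on_infdist g continuous_on_const)
    ultimately show ?thesis
      unfolding sets_baire_algebra by (intro sigma_sets.Basic) simp
  qed (simp add: sets_baire_algebra sigma_sets.Empty)
  then have "UNIV - g -` (- U) \<in> sets baire_algebra"
    by (metis sets.compl_sets space_baire_algebra)
  moreover have "UNIV - g -` (- U) = g -` U" by auto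
  ultimately show "g -` U \<inter> space baire_algebra \<in> sets baire_algebra" by simp
qed

text \<open>A countable set outside \<open>S\<close> can be moved into \<open>S\<close>: for each of
  its points and each scale choose a point of \<open>S\<close> within that scale, if there is one.
  The right-hand side passes easily to sums, limits and linear images.\<close>

lemma separable_space_top_of_set:
  fixes S :: "'e::metric_space set"
  shows "separable_space (top_of_set S) \<longleftrightarrow> (\<exists>D. countable D \<and> S \<subseteq> closure D)"
proof
  assume "separable_space (top_of_set S)"
  then obtain D where "countable D" "top_of_set S closure_of D = S"
    by (auto simp: separable_space_def)
  then have "S \<subseteq> closure (S \<inter> D)" "countable (S \<inter> D)"
    by (auto simp: closure_of_subtopology)
  then show "\<exists>D. countable D \<and> S \<subseteq> closure D" by blast
next
  assume "\<exists>D. countable D \<and> S \<subseteq> closure D"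
  then obtain D where D: "countable D" "S \<subseteq> closure D" by blast
  define pick where "pick d n = (SOME s. s \<in> S \<and> dist d s < 1 / real (Suc n))" for d and n :: nat
  define C where "C = {pick d n |d n. d \<in> D \<and> (\<exists>s\<in>S. dist d s < 1 / real (Suc n))}"
  have pick: "pick d n \<in> S \<and> dist d (pick d n) < 1 / real (Suc n)"
    if "s \<in> S" "dist d s < 1 / real (Suc n)" for d n s
    unfolding pick_def by (rule someI[of _ s]) (use that in simp)
  have C_S: "C \<subseteq> S" using pick by (auto simp: C_def)
  have "C \<subseteq> (\<lambda>(d, n). pick d n) ` (D \<times> UNIV)" by (auto simp: C_def)
  then have "countable C" using D(1) by (meson countable_SIGMA countable_image countable_subset countableI_type)
  moreover have "S \<subseteq> closure C"
  proof
    fix s assume s: "s \<in> S"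
    show "s \<in> closure C"
      unfolding closure_approachable
    proof (intro allI impI)
      fix e :: real assume "0 < e"
      then obtain n where n: "1 / real (Suc n) < e / 2" using nat_approx_posE[of "e / 2"] by auto
      obtain d where d: "d \<in> D" "dist d s < 1 / real (Suc n)"
        using D(2) s unfolding closure_approachable subset_iff by (metis of_nat_0_less_iff zero_less_Suc zero_less_divide_1_iff)
      have "dist (pick d n) s \<le> dist d (pick d n) + dist d s"
        by (rule dist_triangle3)
      also have "\<dots> < e" using pick[OF s d(2)] d(2) n by simp
      finally show "\<exists>c\<in>C. dist c s < e" using d s by (auto simp: C_def)
    qed
  qed
  then have "top_of_set S closure_of C = S"
    using C_S by (auto simp: closure_of_subtopology Int_absorb1)
  ultimately show "separable_space (top_of_set S)"
    using C_S by (auto simp: separable_space_def)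
qed

text \<open>The description of $M(X,E)$ by real-linear functionals, independent of the scalar field.\<close>

definition real_M_space :: "('x::topological_space \<Rightarrow> 'e::real_normed_vector) set" where
  "real_M_space = {f. bounded (range f) \<and> (\<exists>D. countable D \<and> range f \<subseteq> closure D) \<and>
     (\<forall>\<phi>\<in>dual_ball. (\<lambda>x. \<phi> (f x)) \<in> borel_measurable baire_algebra)}"

lemma (in normed_space_over) dual_ball_extension:
  assumes "\<phi> \<in> dual_ball"
  shows "\<exists>\<psi>\<in>dual_space sm. \<forall>y. scalar_re (blinfun_apply \<psi> y) = \<phi> y"
proof -
  have "\<bar>\<phi> y\<bar> \<le> 1 * norm y" for y using dual_ball_le[OF assms] by simp
  from dual_space_extension_of_real_part[OF dual_ball_linear[OF assms] zero_le_one this]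
  show ?thesis by blast
qed

lemma bounded_linear_eq_scaled_dual_ball:
  fixes g :: "'e::real_normed_vector \<Rightarrow> real"
  assumes "bounded_linear g"
  obtains \<phi> c where "\<phi> \<in> dual_ball" "\<And>e. g e = c * \<phi> e"
proof -
  from assms obtain K where K: "0 < K" "\<And>x. norm (g x) \<le> norm x * K"
    using bounded_linear.pos_bounded by blast
  have "linear (\<lambda>e. g e / K)"
    using bounded_linear.linear[OF assms] by (intro linearI) (auto simp: linear_add linear_scale add_divide_distrib)
  then have "(\<lambda>e. g e / K) \<in> dual_ball" using K by (auto simp: dual_ball_def divide_le_eq)
  then show ?thesis by (rule that[of _ K]) (use K in simp)
qed

text \<open>A real functional is the real part of some \<open>\<psi>\<close> in the dual; conversely
  \<open>\<psi>\<close> is a continuous function of the real parts of \<open>\<psi>\<close> and of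
  one scalar multiple of it.\<close>

lemma (in normed_space_over) M_space_eq: "M_space sm = (real_M_space :: ('x::topological_space \<Rightarrow> 'e) set)"
proof -
  have "(\<forall>\<psi>\<in>dual_space sm. (\<lambda>x. blinfun_apply \<psi> (f x)) \<in> borel_measurable baire_algebra) \<longleftrightarrow>
        (\<forall>\<phi>\<in>dual_ball. (\<lambda>x. \<phi> (f x)) \<in> borel_measurable baire_algebra)" for f :: "'x \<Rightarrow> 'e"
  proof (intro iffI ballI)
    fix \<phi> :: "'e \<Rightarrow> real"
    assume "\<forall>\<psi>\<in>dual_space sm. (\<lambda>x. blinfun_apply \<psi> (f x)) \<in> borel_measurable baire_algebra"
      and \<phi>: "\<phi> \<in> dual_ball"
    moreover obtain \<psi> where \<psi>: "\<psi> \<in> dual_space sm" "\<And>y. scalar_re (blinfun_apply \<psi> y) = \<phi> y"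
      using dual_ball_extension[OF \<phi>] by blast
    ultimately have "(\<lambda>x. blinfun_apply \<psi> (f x)) \<in> borel_measurable baire_algebra" by blast
    then have "(\<lambda>x. scalar_re (blinfun_apply \<psi> (f x))) \<in> borel_measurable baire_algebra"
      by (rule borel_measurable_continuous_on[OF linear_continuous_on[OF bounded_linear_scalar_re]])
    then show "(\<lambda>x. \<phi> (f x)) \<in> borel_measurable baire_algebra" by (simp add: \<psi>)
  next
    fix \<psi> :: "'e \<Rightarrow>\<^sub>L 'k"
    assume *: "\<forall>\<phi>\<in>dual_ball. (\<lambda>x. \<phi> (f x)) \<in> borel_measurable baire_algebra"
    have meas: "(\<lambda>x. scalar_re (c * blinfun_apply \<psi> (f x))) \<in> borel_measurable baire_algebra" for c
    proof -
      have "bounded_linear (\<lambda>e. scalar_re (c * blinfun_apply \<psi> e))"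
        by (intro bounded_linear_compose[OF bounded_linear_scalar_re] bounded_linear_compose[OF bounded_linear_mult_right] blinfun.bounded_linear_right)
      then obtain \<phi> d where "\<phi> \<in> dual_ball" "\<And>e. scalar_re (c * blinfun_apply \<psi> e) = d * \<phi> e"
        using bounded_linear_eq_scaled_dual_ball by blast
      then show ?thesis using * by (simp add: borel_measurable_times)
    qed
    obtain i :: 'k and H where H: "continuous_on UNIV H" and eq: "\<And>k. H (scalar_re k, scalar_re (i * k)) = k"
      using scalar_from_re[where 'k = 'k] by metis
    have "(\<lambda>x. (scalar_re (blinfun_apply \<psi> (f x)), scalar_re (i * blinfun_apply \<psi> (f x)))) \<in> borel_measurable baire_algebra"
      using meas[of 1] meas[of i] by simp
    from borel_measurable_continuous_on[OF H this]
    show "(\<lambda>x. blinfun_apply \<psi> (f x)) \<in> borel_measurable baire_algebra" by (simp add: eq)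
  qed
  then show ?thesis
    unfolding M_space_def real_M_space_def separable_space_top_of_set by simp
qed

lemma dual_ball_bounded_linear:
  assumes "\<phi> \<in> dual_ball" shows "bounded_linear \<phi>"
proof (rule bounded_linear_intro[where K = 1])
  note lin = dual_ball_linear[OF assms]
  show "\<phi> (x + y) = \<phi> x + \<phi> y" for x y by (rule linear_add[OF lin])
  show "\<phi> (r *\<^sub>R x) = r *\<^sub>R \<phi> x" for r x by (rule linear_scale[OF lin])
  show "norm (\<phi> x) \<le> norm x * 1" for x using dual_ball_le[OF assms] by simp
qed

lemma continuous_on_dual_ball: "\<phi> \<in> dual_ball \<Longrightarrow> continuous_on S \<phi>"
  by (intro linear_continuous_on dual_ball_bounded_linear)

lemma compact_UNIV_imp_bcontfun:
  fixes f :: "'x::topological_space \<Rightarrow> 'e::real_normed_vector"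
  assumes "compact (UNIV :: 'x set)" "continuous_on UNIV f"
  obtains g where "apply_bcontfun g = f"
proof -
  have "bounded (range f)" using assms by (intro compact_imp_bounded compact_continuous_image)
  then have "f \<in> bcontfun" using assms by (simp add: bcontfun_def)
  then show ?thesis by (intro that[of "Bcontfun f"]) (simp add: Bcontfun_inverse)
qed

text \<open>The range is compact, hence totally bounded, hence separable.\<close>

lemma bcontfun_in_real_M_space:
  fixes f :: "'x::topological_space \<Rightarrow>\<^sub>C 'e::real_normed_vector"
  assumes "compact (UNIV :: 'x set)"
  shows "apply_bcontfun f \<in> real_M_space"
proof -
  have "compact (range (apply_bcontfun f))" using assms by (intro compact_continuous_image) auto
  then have "\<forall>e>0. \<exists>k. finite k \<and> range (apply_bcontfun f) \<subseteq> (\<Union>x\<in>k. ball x e)"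
    by (auto simp: compact_eq_totally_bounded)
  then have "\<exists>k. finite k \<and> range (apply_bcontfun f) \<subseteq> (\<Union>x\<in>k. ball x (1 / real (Suc n)))" for n
    by simp
  then obtain k where k: "\<And>n. finite (k n)"
    "\<And>n. range (apply_bcontfun f) \<subseteq> (\<Union>x\<in>k n. ball x (1 / real (Suc n)))"
    by metis
  have "range (apply_bcontfun f) \<subseteq> closure (\<Union>n. k n)"
  proof
    fix y assume y: "y \<in> range (apply_bcontfun f)"
    show "y \<in> closure (\<Union>n. k n)"
      unfolding closure_approachable
    proof (intro allI impI)
      fix e :: real assume "0 < e"
      then obtain n where n: "1 / real (Suc n) < e" using nat_approx_posE by blast
      obtain x where "x \<in> k n" "dist x y < 1 / real (Suc n)" using k(2)[of n] y by auto
      then show "\<exists>x\<in>\<Union>n. k n. dist x y < e" using n by force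
    qed
  qed
  moreover have "countable (\<Union>n. k n)"
    using countable_finite[OF k(1)] by (rule countable_UN[OF countableI_type])
  moreover have "(\<lambda>x. \<phi> (f x)) \<in> borel_measurable baire_algebra" if "\<phi> \<in> dual_ball" for \<phi>
    by (intro continuous_imp_baire_measurable
        continuous_on_compose2[OF continuous_on_dual_ball[OF that, of UNIV]]) auto
  ultimately show ?thesis
    unfolding real_M_space_def using bounded_apply_bcontfun[of f] by blast
qed

lemma real_M_space_add:
  assumes f: "f \<in> real_M_space" and g: "g \<in> real_M_space"
  shows "(\<lambda>x. f x + g x) \<in> real_M_space"
proof -
  obtain D1 where "countable D1" "range f \<subseteq> closure D1"
    using f unfolding real_M_space_def by blast
  moreover obtain D2 where "countable D2" "range g \<subseteq> closure D2"
    using g unfolding real_M_space_def by blast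
  ultimately have D: "countable D1" "range f \<subseteq> closure D1" "countable D2" "range g \<subseteq> closure D2"
    by blast+
  have "range (\<lambda>x. f x + g x) \<subseteq> closure ((\<lambda>(a, b). a + b) ` (D1 \<times> D2))"
  proof clarify
    fix x
    have "(f x, g x) \<in> closure (D1 \<times> D2)" using D by (auto simp: closure_Times)
    then have "(\<lambda>(a, b). a + b) (f x, g x) \<in> (\<lambda>(a, b). a + b) ` closure (D1 \<times> D2)" by (rule imageI)
    also have "\<dots> \<subseteq> closure ((\<lambda>(a, b). a + b) ` (D1 \<times> D2))"
      by (intro image_closure_subset) (auto simp: split_def closure_subset intro!: continuous_intros)
    finally show "f x + g x \<in> closure ((\<lambda>(a, b). a + b) ` (D1 \<times> D2))" by simp
  qed
  moreover have "countable ((\<lambda>(a, b). a + b) ` (D1 \<times> D2))" using D by auto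
  moreover have "bounded (range (\<lambda>x. f x + g x))"
    using f g by (intro bounded_plus_comp) (auto simp: real_M_space_def)
  moreover have "(\<lambda>x. \<phi> (f x + g x)) \<in> borel_measurable baire_algebra" if "\<phi> \<in> dual_ball" for \<phi>
  proof -
    have "(\<lambda>x. \<phi> (f x) + \<phi> (g x)) \<in> borel_measurable baire_algebra"
      using f g that by (intro borel_measurable_add) (simp_all add: real_M_space_def)
    then show ?thesis using that by (simp add: linear_add[OF dual_ball_linear])
  qed
  ultimately show ?thesis unfolding real_M_space_def by blast
qed

lemma real_M_space_limit:
  assumes u: "\<And>n. u n \<in> real_M_space" and le: "\<And>n x. norm (u n x) \<le> B"
    and lim: "\<And>x. (\<lambda>n. u n x) \<longlonglongrightarrow> f x"
  shows "f \<in> real_M_space"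
proof -
  have "\<exists>D. countable D \<and> range (u n) \<subseteq> closure D" for n
    using u[of n] by (simp add: real_M_space_def)
  then obtain D where D: "\<And>n. countable (D n)" "\<And>n. range (u n) \<subseteq> closure (D n)" by metis
  have "u n x \<in> closure (\<Union>n. D n)" for n x
    using D(2)[of n] closure_mono[of "D n" "\<Union>n. D n"] by auto
  then have "f x \<in> closure (\<Union>n. D n)" for x
    by (intro Lim_in_closed_set[OF _ _ _ lim]) auto
  moreover have "countable (\<Union>n. D n)" using D by auto
  moreover have "norm (f x) \<le> B" for x
    by (rule LIMSEQ_le_const2[OF tendsto_norm[OF lim]]) (use le in auto)
  then have "bounded (range f)" by (auto simp: bounded_iff)
  moreover have "(\<lambda>x. \<phi> (f x)) \<in> borel_measurable baire_algebra" if \<phi>: "\<phi> \<in> dual_ball" for \<phi>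
  proof (rule borel_measurable_LIMSEQ_metric)
    show "(\<lambda>x. \<phi> (u n x)) \<in> borel_measurable baire_algebra" for n
      using u[of n] \<phi> by (simp add: real_M_space_def)
    show "(\<lambda>n. \<phi> (u n x)) \<longlonglongrightarrow> \<phi> (f x)" for x
      by (rule continuous_on_tendsto_compose[OF continuous_on_dual_ball[OF \<phi>, of UNIV] lim]) auto
  qed
  ultimately show ?thesis by (auto simp: real_M_space_def)
qed

text \<open>This is the step of the Pettis measurability theorem where separability of the range is used:
  countably many functionals compute the norms \<open>norm (f x - d)\<close>.\<close>

lemma real_M_space_norm_measurable:
  fixes f :: "'x::topological_space \<Rightarrow> 'e::real_normed_vector"
  assumes f: "f \<in> real_M_space" and d: "range f \<subseteq> closure (range (d :: nat \<Rightarrow> 'e))"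
  shows "(\<lambda>x. norm (f x - d j)) \<in> borel_measurable baire_algebra"
proof -
  have "\<exists>\<phi>\<in>dual_ball. \<phi> (d i - d j) = norm (d i - d j)" for i
    using dual_ball_norming by blast
  then obtain \<phi> where \<phi>: "\<And>i. \<phi> i \<in> dual_ball" "\<And>i. \<phi> i (d i - d j) = norm (d i - d j)" by metis
  have [measurable]: "(\<lambda>x. \<phi> i (f x)) \<in> borel_measurable baire_algebra" for i
    using f \<phi>(1) by (simp add: real_M_space_def)
  have "{x. c < norm (f x - d j)} = (\<Union>i. {x. c < \<phi> i (f x) - \<phi> i (d j)})" for c
  proof (intro equalityI subsetI)
    fix x assume "x \<in> {x. c < norm (f x - d j)}"
    \<comment> \<open>Half of the gap, because the distance from \<open>f x\<close> to
      \<open>d i\<close> is lost twice in the estimate below.\<close>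
    then have e: "0 < (norm (f x - d j) - c) / 2" by simp
    have "f x \<in> closure (range d)" using d by auto
    then obtain i where i: "dist (d i) (f x) < (norm (f x - d j) - c) / 2"
      using e unfolding closure_approachable by blast
    have "norm (f x - d j) \<le> norm (f x - d i) + norm (d i - d j)"
      using norm_triangle_ineq[of "f x - d i" "d i - d j"] by simp
    also have "norm (d i - d j) = \<phi> i (f x - d j) - \<phi> i (f x - d i)"
      using \<phi>(2)[of i] linear_diff[OF dual_ball_linear[OF \<phi>(1)]] by simp
    also have "\<dots> \<le> \<phi> i (f x) - \<phi> i (d j) + norm (f x - d i)"
      using dual_ball_le[OF \<phi>(1), of i "f x - d i"] linear_diff[OF dual_ball_linear[OF \<phi>(1)]] by (simp add: abs_le_iff)
    finally have "c < \<phi> i (f x) - \<phi> i (d j)"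
      using i by (simp add: dist_norm norm_minus_commute)
    then show "x \<in> (\<Union>i. {x. c < \<phi> i (f x) - \<phi> i (d j)})" by blast
  next
    fix x assume "x \<in> (\<Union>i. {x. c < \<phi> i (f x) - \<phi> i (d j)})"
    then obtain i where "c < \<phi> i (f x) - \<phi> i (d j)" by blast
    also have "\<dots> \<le> norm (f x - d j)"
      using dual_ball_le[OF \<phi>(1), of i "f x - d j"] linear_diff[OF dual_ball_linear[OF \<phi>(1)]] by (simp add: abs_le_iff)
    finally show "x \<in> {x. c < norm (f x - d j)}" by simp
  qed
  moreover have "{x \<in> space baire_algebra. c < \<phi> i (f x) - \<phi> i (d j)} \<in> sets baire_algebra" for c i
    by measurable
  ultimately show ?thesis
    unfolding borel_measurable_iff_greater by (auto intro!: sets.countable_UN)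
qed

text \<open>Partial products of Urysohn functions that are 1 on \<open>A\<close> and 0 off
  \<open>U n\<close>: for \<open>x\<close> outside \<open>A\<close> one factor vanishes, and all
  later products with it. The single functions need not converge, as the sets \<open>U n\<close>
  need not be nested.\<close>

lemma closed_gdelta_indicator_limit:
  fixes A :: "'x::t2_space set"
  assumes X: "compact (UNIV :: 'x set)" and A: "closed A" "gdelta A"
  obtains h :: "nat \<Rightarrow> 'x \<Rightarrow> real" where "\<And>n. continuous_on UNIV (h n)" "\<And>n x. 0 \<le> h n x \<and> h n x \<le> 1"
    and "\<And>x. (\<lambda>n. h n x) \<longlonglongrightarrow> indicator A x"
proof -
  have "Hausdorff_space (euclidean :: 'x topology)"
    unfolding Hausdorff_space_def disjnt_def using hausdorff by fastforce
  then have normal: "normal_space (euclidean :: 'x topology)"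
    using X by (intro compact_Hausdorff_or_regular_imp_normal_space) (simp_all add: compact_space_def)
  obtain U where U: "\<And>n::nat. open (U n)" "A = (\<Inter>n. U n)"
    using A(2) by (auto elim: gdelta.cases)
  have "\<exists>g. continuous_on UNIV g \<and> (\<forall>x. 0 \<le> g x \<and> g x \<le> (1::real)) \<and> (\<forall>x\<in>A. g x = 1) \<and> (\<forall>x. x \<notin> U n \<longrightarrow> g x = 0)" for n
  proof -
    have "disjnt (- U n) A" using U(2) by (auto simp: disjnt_def)
    then obtain g where "continuous_map euclidean (top_of_set {0..1::real}) g" "g ` (- U n) \<subseteq> {0}" "g ` A \<subseteq> {1}"
      using Urysohn_lemma[OF normal, of "- U n" A 0 1] U(1)[of n] A(1) by auto
    then show ?thesis by (intro exI[of _ g]) (auto simp: continuous_map_in_subtopology)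
  qed
  then obtain g where g: "\<And>n. continuous_on UNIV (g n)" "\<And>n x. 0 \<le> g n x \<and> g n x \<le> (1::real)"
    "\<And>n x. x \<in> A \<Longrightarrow> g n x = 1" "\<And>n x. x \<notin> U n \<Longrightarrow> g n x = 0" by metis
  show ?thesis
  proof (rule that[of "\<lambda>n x. \<Prod>i<n. g i x"])
    show "continuous_on UNIV (\<lambda>x. \<Prod>i<n. g i x)" for n by (intro continuous_on_prod g)
    show "0 \<le> (\<Prod>i<n. g i x) \<and> (\<Prod>i<n. g i x) \<le> 1" for n x
      using g(2) by (auto intro: prod_nonneg prod_le_1)
    show "(\<lambda>n. \<Prod>i<n. g i x) \<longlonglongrightarrow> indicator A x" for x
    proof (cases "x \<in> A")
      case True
      then show ?thesis by (simp add: g(3))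
    next
      case False
      then obtain m where "x \<notin> U m" using U(2) by blast
      then have "(\<Prod>i<n. g i x) = 0" if "Suc m \<le> n" for n
        using that g(4)[of x m] by (intro prod_zero) (auto intro!: bexI[of _ m])
      then have "eventually (\<lambda>n. (\<Prod>i<n. g i x) = 0) sequentially"
        unfolding eventually_sequentially by blast
      then show ?thesis using False by (simp add: tendsto_eventually)
    qed
  qed
qed

theorem real_M_space_induct [consumes 2, case_names bcontfun add limit]:
  fixes f :: "'x::t2_space \<Rightarrow> 'e::real_normed_vector"
  assumes X: "compact (UNIV :: 'x set)" and f: "f \<in> real_M_space"
    and cont: "\<And>f :: 'x \<Rightarrow>\<^sub>C 'e. P (apply_bcontfun f)"
    and add: "\<And>f g. P f \<Longrightarrow> P g \<Longrightarrow> P (\<lambda>x. f x + g x)"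
    and lim: "\<And>u f B. (\<And>n. P (u n)) \<Longrightarrow> (\<And>n x. norm (u n x) \<le> B) \<Longrightarrow>
      (\<And>x. (\<lambda>n. u n x) \<longlonglongrightarrow> f x) \<Longrightarrow> P f"
  shows "P f"
proof -
  have P_cont: "P g" if g: "continuous_on UNIV g" for g
  proof -
    obtain h where "apply_bcontfun h = g" by (rule compact_UNIV_imp_bcontfun[OF X g])
    then show ?thesis using cont[of h] by simp
  qed
  have P_sum: "P (\<lambda>x. \<Sum>i<n. g i x)" if "\<And>i. i < n \<Longrightarrow> P (g i)" for g :: "nat \<Rightarrow> 'x \<Rightarrow> 'e" and n
    using that by (induction n) (auto intro: add P_cont)
  have stable: "Int_stable {A :: 'x set. closed A \<and> gdelta A}"
  proof (rule Int_stableI)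
    fix A B :: "'x set" assume A: "A \<in> {A. closed A \<and> gdelta A}" and B: "B \<in> {A. closed A \<and> gdelta A}"
    then obtain U V where "\<And>n::nat. open (U n)" "A = (\<Inter>n. U n)" "\<And>n::nat. open (V n)" "B = (\<Inter>n. V n)"
      by (auto elim!: gdelta.cases)
    then have "A \<inter> B = (\<Inter>n. U n \<inter> V n)" "\<And>n. open (U n \<inter> V n)" by auto
    then have "gdelta (A \<inter> B)" using gdelta.intros[of "\<lambda>n. U n \<inter> V n"] by simp
    then show "A \<inter> B \<in> {A. closed A \<and> gdelta A}" using A B by auto
  qed
  have sub: "{A :: 'x set. closed A \<and> gdelta A} \<subseteq> Pow UNIV" by simp
  \<comment> \<open>The vector is quantified inside the induction: the complement step uses the
    hypothesis for \<open>- e\<close>, as \<open>P\<close> is not assumed to be closed under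
    scaling.\<close>
  have P_ind: "\<forall>e. P (\<lambda>x. indicat_real A x *\<^sub>R e)" if "A \<in> sets baire_algebra" for A
    using stable sub that[unfolded sets_baire_algebra]
  proof (induction rule: sigma_sets_induct_disjoint)
    case (basic A)
    then have A: "closed A" "gdelta A" by auto
    obtain h :: "nat \<Rightarrow> 'x \<Rightarrow> real" where h: "\<And>n. continuous_on UNIV (h n)" "\<And>n x. 0 \<le> h n x \<and> h n x \<le> 1"
      "\<And>x. (\<lambda>n. h n x) \<longlonglongrightarrow> indicator A x"
      by (rule closed_gdelta_indicator_limit[OF X A]) auto
    show ?case
    proof
      fix e :: 'e
      show "P (\<lambda>x. indicat_real A x *\<^sub>R e)"
      proof (rule lim[where B = "norm e"])
        show "P (\<lambda>x. h n x *\<^sub>R e)" for n by (intro P_cont continuous_intros h)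
        show "norm (h n x *\<^sub>R e) \<le> norm e" for n x
          using h(2)[of n x] by (simp add: mult_left_le_one_le)
        show "(\<lambda>n. h n x *\<^sub>R e) \<longlonglongrightarrow> indicat_real A x *\<^sub>R e" for x
          by (intro tendsto_intros h)
      qed
    qed
  next
    case empty
    show ?case by (auto intro!: P_cont)
  next
    case (compl A)
    show ?case
    proof
      fix e :: 'e
      have "P (\<lambda>x. indicat_real A x *\<^sub>R (- e))" using compl(2) by blast
      from add[OF P_cont[OF continuous_on_const] this]
      have "P (\<lambda>x. e + indicat_real A x *\<^sub>R (- e))" .
      moreover have "(\<lambda>x. e + indicat_real A x *\<^sub>R (- e)) = (\<lambda>x. indicat_real (UNIV - A) x *\<^sub>R e)"
        by (auto simp: fun_eq_iff indicator_def)
      ultimately show "P (\<lambda>x. indicat_real (UNIV - A) x *\<^sub>R e)" by simp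
    qed
  next
    case (union A)
    show ?case
    proof
      fix e :: 'e
      \<comment> \<open>By disjointness the partial sums are indicators of finite unions, which
        keeps them bounded by \<open>norm e\<close>.\<close>
      have eq: "(\<Sum>i<n. indicat_real (A i) x *\<^sub>R e) = indicat_real (\<Union>i<n. A i) x *\<^sub>R e" for n x
        using union(1) by (simp add: indicator_UN_disjoint disjoint_family_on_mono[OF subset_UNIV] scaleR_left.sum)
      show "P (\<lambda>x. indicat_real (\<Union>i. A i) x *\<^sub>R e)"
      proof (rule lim[where B = "norm e"])
        show "P (\<lambda>x. \<Sum>i<n. indicat_real (A i) x *\<^sub>R e)" for n
          using union by (intro P_sum) auto
        show "norm (\<Sum>i<n. indicat_real (A i) x *\<^sub>R e) \<le> norm e" for n x
          unfolding eq by (simp add: indicator_def)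
        show "(\<lambda>n. \<Sum>i<n. indicat_real (A i) x *\<^sub>R e) \<longlonglongrightarrow> indicat_real (\<Union>i. A i) x *\<^sub>R e" for x
          unfolding eq by (intro tendsto_intros LIMSEQ_indicator_UN)
      qed
    qed
  qed
  obtain D where "countable D" "range f \<subseteq> closure D"
    using f unfolding real_M_space_def by blast
  moreover from this have "D \<noteq> {}" by auto
  ultimately obtain d :: "nat \<Rightarrow> 'e" where d: "range f \<subseteq> closure (range d)"
    by (metis uncountable_def)
  obtain B where B: "\<And>x. norm (f x) \<le> B"
    using f by (auto simp: real_M_space_def bounded_iff)
  note [measurable] = real_M_space_norm_measurable[OF f d]
  \<comment> \<open>The index of a point nearest to \<open>f x\<close> among
    \<open>d 0, ..., d n\<close>. Taking the least one breaks ties measurably.\<close>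
  define near where "near n x = (LEAST i. i \<le> n \<and> (\<forall>k\<le>n. norm (f x - d i) \<le> norm (f x - d k)))" for n x
  have near: "near n x \<le> n" "k \<le> n \<Longrightarrow> norm (f x - d (near n x)) \<le> norm (f x - d k)" for n k x
  proof -
    obtain i where "i \<le> n" "\<forall>k\<le>n. norm (f x - d i) \<le> norm (f x - d k)"
      using ex_min_if_finite[of "(\<lambda>k. norm (f x - d k)) ` {..n}"] by (force simp: not_less)
    then have "\<exists>i. i \<le> n \<and> (\<forall>k\<le>n. norm (f x - d i) \<le> norm (f x - d k))" by blast
    from LeastI_ex[OF this] show "near n x \<le> n" "k \<le> n \<Longrightarrow> norm (f x - d (near n x)) \<le> norm (f x - d k)"
      unfolding near_def by blast+
  qed
  have near_sets: "{x. near n x = i} \<in> sets baire_algebra" for n i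
  proof -
    have "near n \<in> measurable baire_algebra (count_space UNIV)"
      unfolding near_def by measurable
    from measurable_sets[OF this, of "{i}"] show ?thesis by (simp add: vimage_def)
  qed
  have B0: "0 \<le> B" using B[of undefined] norm_ge_zero order_trans by blast
  show "P f"
  proof (rule lim)
    show "P (\<lambda>x. d (near n x))" for n
    proof -
      have "P (\<lambda>x. \<Sum>i<Suc n. indicat_real {x. near n x = i} x *\<^sub>R d i)"
        using P_ind[OF near_sets] by (intro P_sum) auto
      moreover have "(\<Sum>i<Suc n. indicat_real {x. near n x = i} x *\<^sub>R d i) = d (near n x)" for x
        using near(1)[of n x] by (subst sum.remove[of _ "near n x"]) (auto simp: indicator_def intro!: sum.neutral)
      ultimately show ?thesis by simp
    qed
    \<comment> \<open>The bound arises because \<open>d 0\<close> is a candidate for every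
      \<open>n\<close>.\<close>
    show "norm (d (near n x)) \<le> 2 * B + norm (d 0)" for n x
    proof -
      have "norm (d (near n x)) \<le> norm (f x) + norm (f x - d (near n x))"
        by (metis norm_minus_commute norm_triangle_sub)
      also have "\<dots> \<le> norm (f x) + norm (f x - d 0)" by (intro add_left_mono near) simp
      also have "\<dots> \<le> norm (f x) + (norm (f x) + norm (d 0))"
        by (intro add_left_mono norm_triangle_ineq4)
      finally show ?thesis using B[of x] by simp
    qed
    show "(\<lambda>n. d (near n x)) \<longlonglongrightarrow> f x" for x
    proof (rule LIMSEQ_I)
      fix r :: real assume "0 < r"
      moreover have "f x \<in> closure (range d)" using d by auto
      ultimately obtain k where k: "dist (d k) (f x) < r" unfolding closure_approachable by blast
      have "norm (d (near n x) - f x) < r" if "k \<le> n" for n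
        using near(2)[OF that, of x] k by (simp add: dist_norm norm_minus_commute)
      then show "\<exists>no. \<forall>n\<ge>no. norm (d (near n x) - f x) < r" by blast
    qed
  qed
qed

lemma real_M_space_bounded: "f \<in> real_M_space \<Longrightarrow> \<exists>B. \<forall>x. norm (f x) \<le> B"
  by (auto simp: real_M_space_def bounded_iff)

lemma real_M_space_bounded_linear:
  assumes A: "bounded_linear A" and f: "f \<in> real_M_space"
  shows "(\<lambda>x. A (f x)) \<in> real_M_space"
proof -
  obtain D where D: "countable D" "range f \<subseteq> closure D"
    using f unfolding real_M_space_def by blast
  have "A ` closure D \<subseteq> closure (A ` D)"
    by (intro image_closure_subset linear_continuous_on[OF A]) (auto simp: closure_subset)
  then have "range (\<lambda>x. A (f x)) \<subseteq> closure (A ` D)" using D by blast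
  moreover have "countable (A ` D)" using D by simp
  moreover have "bounded (range (\<lambda>x. A (f x)))"
    using bounded_linear_image[OF _ A, of "range f"] f by (simp add: real_M_space_def image_image)
  moreover have "(\<lambda>x. \<phi> (A (f x))) \<in> borel_measurable baire_algebra" if \<phi>: "\<phi> \<in> dual_ball" for \<phi>
  proof -
    from bounded_linear_compose[OF dual_ball_bounded_linear[OF \<phi>] A]
    obtain \<phi>' c where "\<phi>' \<in> dual_ball" "\<And>e. \<phi> (A e) = c * \<phi>' e"
      by (rule bounded_linear_eq_scaled_dual_ball) auto
    then show ?thesis using f by (simp add: real_M_space_def borel_measurable_times)
  qed
  ultimately show ?thesis unfolding real_M_space_def by blast
qed

section \<open>Extension of functionals\<close>

text \<open>The real counterpart of the extension property for a single y in F: weak convergence is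
  tested with all bounded real-linear functionals, so the scalar field does not occur.\<close>

definition weakly_normal :: "(('x::topological_space \<Rightarrow> 'e::real_normed_vector) \<Rightarrow> real) \<Rightarrow> bool" where
  "weakly_normal L \<longleftrightarrow>
     (\<forall>f\<in>real_M_space. \<forall>g\<in>real_M_space. L (\<lambda>x. f x + g x) = L f + L g) \<and>
     (\<forall>u f B. (\<forall>n. u n \<in> real_M_space) \<longrightarrow> f \<in> real_M_space \<longrightarrow> (\<forall>n x. norm (u n x) \<le> B) \<longrightarrow>
        (\<forall>g x. bounded_linear g \<longrightarrow> (\<lambda>n. g (u n x)) \<longlonglongrightarrow> (g (f x) :: real)) \<longrightarrow>
        (\<lambda>n. L (u n)) \<longlonglongrightarrow> L f)"

lemma weakly_normalI:
  fixes L :: "('x::topological_space \<Rightarrow> 'e::real_normed_vector) \<Rightarrow> real"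
  assumes "\<And>f g. f \<in> real_M_space \<Longrightarrow> g \<in> real_M_space \<Longrightarrow> L (\<lambda>x. f x + g x) = L f + L g"
    and "\<And>u f B. (\<And>n. u n \<in> real_M_space) \<Longrightarrow> f \<in> real_M_space \<Longrightarrow> (\<And>n x. norm (u n x) \<le> B) \<Longrightarrow>
      (\<And>g x. bounded_linear g \<Longrightarrow> (\<lambda>n. g (u n x)) \<longlonglongrightarrow> (g (f x) :: real)) \<Longrightarrow>
      (\<lambda>n. L (u n)) \<longlonglongrightarrow> L f"
  shows "weakly_normal L"
  unfolding weakly_normal_def
proof (intro conjI ballI allI impI)
  fix u :: "nat \<Rightarrow> 'x \<Rightarrow> 'e" and f B
  assume "\<forall>n. u n \<in> real_M_space" "f \<in> real_M_space" "\<forall>n x. norm (u n x) \<le> B"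
    and "\<forall>g x. bounded_linear g \<longrightarrow> (\<lambda>n. g (u n x)) \<longlonglongrightarrow> (g (f x) :: real)"
  then show "(\<lambda>n. L (u n)) \<longlonglongrightarrow> L f" by (intro assms(2)[of u f B]) simp_all
qed (rule assms(1))

lemma weakly_normal_add:
  "weakly_normal L \<Longrightarrow> f \<in> real_M_space \<Longrightarrow> g \<in> real_M_space \<Longrightarrow> L (\<lambda>x. f x + g x) = L f + L g"
  by (simp add: weakly_normal_def)

lemma weakly_normal_tendsto:
  assumes "weakly_normal L" "\<And>n. u n \<in> real_M_space" "f \<in> real_M_space" "\<And>n x. norm (u n x) \<le> B"
    and "\<And>g x. bounded_linear g \<Longrightarrow> (\<lambda>n. g (u n x)) \<longlonglongrightarrow> (g (f x) :: real)"
  shows "(\<lambda>n. L (u n)) \<longlonglongrightarrow> L f"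
  using assms unfolding weakly_normal_def by blast

lemma weakly_normal_unique:
  fixes L1 L2 :: "('x::t2_space \<Rightarrow> 'e::real_normed_vector) \<Rightarrow> real"
  assumes X: "compact (UNIV :: 'x set)" and L: "weakly_normal L1" "weakly_normal L2"
    and eq: "\<And>f. L1 (apply_bcontfun f) = L2 (apply_bcontfun f)" and f: "f \<in> real_M_space"
  shows "L1 f = L2 f"
proof -
  \<comment> \<open>Membership is carried along, because additivity and continuity of
    \<open>L1\<close> and \<open>L2\<close> are available on \<open>real_M_space\<close>
    only.\<close>
  have "f \<in> real_M_space \<and> L1 f = L2 f"
    using X f
  proof (induction rule: real_M_space_induct)
    case (bcontfun f)
    then show ?case using bcontfun_in_real_M_space[OF X] eq by blast
  next
    case (add f g)
    then show ?case using L by (simp add: real_M_space_add weakly_normal_add)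
  next
    case (limit u f B)
    then have u: "\<And>n. u n \<in> real_M_space" and u_eq: "\<And>n. L1 (u n) = L2 (u n)" by auto
    have f: "f \<in> real_M_space" by (rule real_M_space_limit[OF u limit(2,3)])
    have lim: "(\<lambda>n. g (u n x)) \<longlonglongrightarrow> g (f x)" if "bounded_linear g" for g x
      by (rule bounded_linear.tendsto[OF that limit(3)])
    have "(\<lambda>n. L1 (u n)) \<longlonglongrightarrow> L1 f" "(\<lambda>n. L2 (u n)) \<longlonglongrightarrow> L2 f"
      using L by (auto intro: weakly_normal_tendsto[OF _ u f limit(2) lim])
    then show ?case using f u_eq by (auto intro: LIMSEQ_unique)
  qed
  then show ?thesis by blast
qed

text \<open>This and the next two closure properties supply the functionals that uniqueness compares
  when linearity of the extension is proved.\<close>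

lemma weakly_normal_plus:
  assumes "weakly_normal L1" "weakly_normal L2" shows "weakly_normal (\<lambda>f. L1 f + L2 f)"
proof (rule weakly_normalI)
  show "L1 (\<lambda>x. f x + g x) + L2 (\<lambda>x. f x + g x) = L1 f + L2 f + (L1 g + L2 g)"
    if "f \<in> real_M_space" "g \<in> real_M_space" for f g
    using weakly_normal_add[OF assms(1) that] weakly_normal_add[OF assms(2) that] by simp
next
  fix u :: "nat \<Rightarrow> 'a \<Rightarrow> 'b" and f B
  assume *: "\<And>n. u n \<in> real_M_space" "f \<in> real_M_space" "\<And>n x. norm (u n x) \<le> B"
    "\<And>g x. bounded_linear g \<Longrightarrow> (\<lambda>n. g (u n x)) \<longlonglongrightarrow> (g (f x) :: real)"
  show "(\<lambda>n. L1 (u n) + L2 (u n)) \<longlonglongrightarrow> L1 f + L2 f"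
    by (rule tendsto_add[OF weakly_normal_tendsto[OF assms(1) *] weakly_normal_tendsto[OF assms(2) *]])
qed

lemma weakly_normal_scale:
  assumes "weakly_normal L" shows "weakly_normal (\<lambda>f. r * L f)"
proof (rule weakly_normalI)
  show "r * L (\<lambda>x. f x + g x) = r * L f + r * L g"
    if "f \<in> real_M_space" "g \<in> real_M_space" for f g
    using weakly_normal_add[OF assms that] by (simp add: distrib_left)
next
  fix u :: "nat \<Rightarrow> 'a \<Rightarrow> 'b" and f B
  assume *: "\<And>n. u n \<in> real_M_space" "f \<in> real_M_space" "\<And>n x. norm (u n x) \<le> B"
    "\<And>g x. bounded_linear g \<Longrightarrow> (\<lambda>n. g (u n x)) \<longlonglongrightarrow> (g (f x) :: real)"
  show "(\<lambda>n. r * L (u n)) \<longlonglongrightarrow> r * L f"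
    by (rule tendsto_mult_left[OF weakly_normal_tendsto[OF assms *]])
qed

lemma weakly_normal_compose:
  assumes L: "weakly_normal L" and A: "bounded_linear A"
  shows "weakly_normal (\<lambda>f. L (\<lambda>x. A (f x)))"
proof (rule weakly_normalI)
  fix f g :: "'a \<Rightarrow> 'c" assume "f \<in> real_M_space" "g \<in> real_M_space"
  note AM = this[THEN real_M_space_bounded_linear[OF A]]
  show "L (\<lambda>x. A (f x + g x)) = L (\<lambda>x. A (f x)) + L (\<lambda>x. A (g x))"
    using weakly_normal_add[OF L AM] by (simp add: linear_add[OF bounded_linear.linear[OF A]])
next
  fix u :: "nat \<Rightarrow> 'a \<Rightarrow> 'c" and f B
  assume u: "\<And>n. u n \<in> real_M_space" and f: "f \<in> real_M_space" and B: "\<And>n x. norm (u n x) \<le> B"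
    and lim: "\<And>g x. bounded_linear g \<Longrightarrow> (\<lambda>n. g (u n x)) \<longlonglongrightarrow> (g (f x) :: real)"
  obtain K where K: "0 \<le> K" "\<And>x. norm (A x) \<le> norm x * K"
    using bounded_linear.nonneg_bounded[OF A] by blast
  show "(\<lambda>n. L (\<lambda>x. A (u n x))) \<longlonglongrightarrow> L (\<lambda>x. A (f x))"
  proof (rule weakly_normal_tendsto[OF L])
    show "(\<lambda>x. A (u n x)) \<in> real_M_space" for n by (rule real_M_space_bounded_linear[OF A u])
    show "(\<lambda>x. A (f x)) \<in> real_M_space" by (rule real_M_space_bounded_linear[OF A f])
    show "norm (A (u n x)) \<le> B * K" for n x
      using K(2)[of "u n x"] mult_right_mono[OF B[of n x] K(1)] by simp
    show "(\<lambda>n. g (A (u n x))) \<longlonglongrightarrow> g (A (f x))" if "bounded_linear g" for g :: "'b \<Rightarrow> real" and x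
      by (rule lim[OF bounded_linear_compose[OF that A]])
  qed
qed

text \<open>The bound is stated for differences since it serves twice: with \<open>g\<close> the
  zero function it bounds the norm, and in general it gives Lipschitz continuity.\<close>

theorem weakly_normal_extension:
  fixes l :: "('x::t2_space \<Rightarrow>\<^sub>C 'e::real_normed_vector) \<Rightarrow> real"
  assumes X: "compact (UNIV :: 'x set)" and l: "linear l"
    and C: "0 \<le> C" and l_le: "\<And>f. \<bar>l f\<bar> \<le> C * norm f"
  shows "\<exists>L. weakly_normal L \<and> (\<forall>f. L (apply_bcontfun f) = l f) \<and>
    (\<forall>f\<in>real_M_space. \<forall>g\<in>real_M_space. \<forall>b. (\<forall>x. norm (f x - g x) \<le> b) \<longrightarrow> \<bar>L f - L g\<bar> \<le> C * b)"
proof -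
  obtain M :: "('x \<times> ('e \<Rightarrow> real)) measure"
    where space: "space M = UNIV \<times> dual_ball" and fin: "finite_measure M" and C_M: "measure M (space M) \<le> C"
    and meas_cont: "\<And>f. (\<lambda>(x, \<phi>). \<phi> (apply_bcontfun f x)) \<in> borel_measurable M"
    and int_cont: "\<And>f. (\<integral>(x, \<phi>). \<phi> (apply_bcontfun f x) \<partial>M) = l f"
    by (rule functional_as_measure[OF X l C l_le]) auto
  interpret finite_measure M by (rule fin)
  define G where "G f = (\<lambda>(x, \<phi>). \<phi> (f x) :: real)" for f :: "'x \<Rightarrow> 'e"
  have G_add: "G (\<lambda>x. f x + g x) z = G f z + G g z" and G_diff: "G (\<lambda>x. f x - g x) z = G f z - G g z"
    if "z \<in> space M" for f g z
    using that by (auto simp: space G_def linear_add[OF dual_ball_linear] linear_diff[OF dual_ball_linear])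
  have G_le: "\<bar>G f z\<bar> \<le> b" if "z \<in> space M" "\<And>x. norm (f x) \<le> b" for f z b
  proof -
    obtain x \<phi> where z: "z = (x, \<phi>)" "\<phi> \<in> dual_ball" using \<open>z \<in> space M\<close> by (auto simp: space)
    then show ?thesis using dual_ball_le[OF z(2), of "f x"] that(2)[of x] by (simp add: G_def)
  qed
  \<comment> \<open>For continuous \<open>f\<close> this is part of the choice of \<open>M\<close>.
    The induction carries it over to \<open>real_M_space\<close>, where additivity of the pairing
    holds on the space of \<open>M\<close> because each \<phi> is linear there.\<close>
  have G_meas: "G f \<in> borel_measurable M" if "f \<in> real_M_space" for f
    using X that
  proof (induction rule: real_M_space_induct)
    case (bcontfun f)
    then show ?case using meas_cont by (simp add: G_def)
  next
    case (add f g)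
    then have "(\<lambda>z. G f z + G g z) \<in> borel_measurable M" by (rule borel_measurable_add)
    then show ?case by (subst measurable_cong[OF G_add])
  next
    case (limit u f B)
    show ?case
    proof (rule borel_measurable_LIMSEQ_metric[OF limit(1)])
      fix z assume "z \<in> space M"
      then obtain x \<phi> where z: "z = (x, \<phi>)" "\<phi> \<in> dual_ball" by (auto simp: space)
      then show "(\<lambda>n. G (u n) z) \<longlonglongrightarrow> G f z"
        unfolding G_def using continuous_on_tendsto_compose[OF continuous_on_dual_ball[OF z(2), of UNIV] limit(3)[of x]] by simp
    qed
  qed
  have G_int: "integrable M (G f)" if f: "f \<in> real_M_space" for f
  proof -
    obtain B where "\<And>x. norm (f x) \<le> B" using real_M_space_bounded[OF f] by blast
    then show ?thesis using G_le[of _ f B] by (intro integrable_const_bound[where B = B] G_meas f AE_I2) auto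
  qed
  define L where "L f = integral\<^sup>L M (G f)" for f
  have "weakly_normal L"
  proof (rule weakly_normalI)
    fix f g :: "'x \<Rightarrow> 'e" assume fg: "f \<in> real_M_space" "g \<in> real_M_space"
    have "L (\<lambda>x. f x + g x) = (\<integral>z. G f z + G g z \<partial>M)"
      unfolding L_def by (intro Bochner_Integration.integral_cong refl G_add)
    then show "L (\<lambda>x. f x + g x) = L f + L g"
      using fg by (simp add: L_def G_int)
  next
    fix u and f :: "'x \<Rightarrow> 'e" and B
    assume u: "\<And>n. u n \<in> real_M_space" and f: "f \<in> real_M_space" and B: "\<And>n x. norm (u n x) \<le> B"
      and lim: "\<And>g x. bounded_linear g \<Longrightarrow> (\<lambda>n. g (u n x)) \<longlonglongrightarrow> (g (f x) :: real)"
    show "(\<lambda>n. L (u n)) \<longlonglongrightarrow> L f"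
      unfolding L_def
    \<comment> \<open>Weak convergence at \<open>x\<close> is convergence at every point
      \<open>(x, \<phi>)\<close>, and the constant \<open>B\<close> is integrable because
      \<open>M\<close> is finite.\<close>
    proof (rule integral_dominated_convergence[where w = "\<lambda>_. B"])
      show "AE z in M. (\<lambda>n. G (u n) z) \<longlonglongrightarrow> G f z"
      proof (rule AE_I2)
        fix z assume "z \<in> space M"
        then obtain x \<phi> where z: "z = (x, \<phi>)" "\<phi> \<in> dual_ball" by (auto simp: space)
        show "(\<lambda>n. G (u n) z) \<longlonglongrightarrow> G f z"
          using lim[OF dual_ball_bounded_linear[OF z(2)], of x] by (simp add: z(1) G_def)
      qed
      show "AE z in M. norm (G (u n) z) \<le> B" for n
        using G_le[of _ "u n" B] B by (intro AE_I2) auto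
    qed (use u f in \<open>auto intro: G_meas\<close>)
  qed
  moreover have "L (apply_bcontfun f) = l f" for f
    using int_cont[of f] by (simp add: L_def G_def)
  moreover have "\<bar>L f - L g\<bar> \<le> C * b"
    if f: "f \<in> real_M_space" and g: "g \<in> real_M_space" and b: "\<forall>x. norm (f x - g x) \<le> b" for f g b
  proof -
    have b0: "0 \<le> b" using b norm_ge_zero order_trans by blast
    have "\<bar>L f - L g\<bar> = \<bar>\<integral>z. G f z - G g z \<partial>M\<bar>"
      using G_int[OF f] G_int[OF g] by (simp add: L_def)
    also have "\<dots> \<le> (\<integral>z. \<bar>G f z - G g z\<bar> \<partial>M)"
      by (rule integral_abs_bound)
    also have "\<dots> \<le> (\<integral>z. b \<partial>M)"
    proof (rule integral_mono)
      show "\<bar>G f z - G g z\<bar> \<le> b" if "z \<in> space M" for z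
        using G_le[OF that, of "\<lambda>x. f x - g x" b] b G_diff[OF that, of f g] by simp
    qed (use G_int[OF f] G_int[OF g] in auto)
    also have "\<dots> \<le> C * b" using C_M b0 by (simp add: mult_right_mono)
    finally show ?thesis .
  qed
  ultimately show ?thesis by blast
qed

section \<open>From real functionals back to the dual space\<close>

lemma dual_space_add: "\<psi>1 \<in> dual_space sm \<Longrightarrow> \<psi>2 \<in> dual_space sm \<Longrightarrow> \<psi>1 + \<psi>2 \<in> dual_space sm"
  and dual_space_diff: "\<psi>1 \<in> dual_space sm \<Longrightarrow> \<psi>2 \<in> dual_space sm \<Longrightarrow> \<psi>1 - \<psi>2 \<in> dual_space sm"
  by (simp_all add: dual_space_def blinfun.add_left blinfun.diff_left algebra_simps)

lemma dual_scale_apply [simp]: "blinfun_apply (dual_scale c \<psi>) y = c * blinfun_apply \<psi> y"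
  by (simp add: dual_scale_def)

lemma dual_space_scale: "\<psi> \<in> dual_space sm \<Longrightarrow> dual_scale c \<psi> \<in> dual_space sm"
  by (simp add: dual_space_def mult.left_commute)

text \<open>A functional is the only one with its real part, so it coincides with the extension of
  that real part and inherits its norm bound.\<close>

lemma (in normed_space_over) norm_dual_space_le:
  assumes \<psi>: "\<psi> \<in> dual_space sm" and C: "0 \<le> C" and le: "\<And>y. \<bar>scalar_re (blinfun_apply \<psi> y)\<bar> \<le> C * norm y"
  shows "norm \<psi> \<le> C"
proof -
  have "linear (\<lambda>y. scalar_re (blinfun_apply \<psi> y))"
    by (intro bounded_linear.linear bounded_linear_compose[OF bounded_linear_scalar_re] blinfun.bounded_linear_right)
  from dual_space_extension_of_real_part[OF this C le]
  obtain \<psi>' where "\<psi>' \<in> dual_space sm" "\<And>y. scalar_re (blinfun_apply \<psi>' y) = scalar_re (blinfun_apply \<psi> y)" "norm \<psi>' \<le> C"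
    by blast
  then show ?thesis using dual_space_eqI[of \<psi>' sm \<psi>] \<psi> by simp
qed

lemma (in normed_space_over) limitin_weak_topology_real:
  "limitin (weak_topology sm) u a F \<longleftrightarrow>
     (\<forall>g. bounded_linear g \<longrightarrow> ((\<lambda>n. g (u n)) \<longlongrightarrow> (g a :: real)) F)"
  unfolding limitin_weak_topology
proof (intro iffI allI impI ballI)
  fix g :: "'e \<Rightarrow> real"
  assume *: "\<forall>\<psi>\<in>dual_space sm. ((\<lambda>n. blinfun_apply \<psi> (u n)) \<longlongrightarrow> blinfun_apply \<psi> a) F" and "bounded_linear g"
  then obtain \<phi> c where \<phi>: "\<phi> \<in> dual_ball" and g: "\<And>e. g e = c * \<phi> e"
    using bounded_linear_eq_scaled_dual_ball by blast
  obtain \<psi> where "\<psi> \<in> dual_space sm" "\<forall>y. scalar_re (blinfun_apply \<psi> y) = \<phi> y"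
    using dual_ball_extension[OF \<phi>] by blast
  then have "((\<lambda>n. \<phi> (u n)) \<longlongrightarrow> \<phi> a) F"
    using bounded_linear.tendsto[OF bounded_linear_scalar_re, of "\<lambda>n. blinfun_apply \<psi> (u n)"] * by fastforce
  then show "((\<lambda>n. g (u n)) \<longlongrightarrow> g a) F"
    unfolding g by (rule tendsto_mult_left)
next
  fix \<psi> :: "'e \<Rightarrow>\<^sub>L 'k"
  assume *: "\<forall>g. bounded_linear g \<longrightarrow> ((\<lambda>n. g (u n)) \<longlongrightarrow> (g a :: real)) F"
  have bl: "bounded_linear (\<lambda>e. scalar_re (c * blinfun_apply \<psi> e))" for c
    by (intro bounded_linear_compose[OF bounded_linear_scalar_re] bounded_linear_compose[OF bounded_linear_mult_right] blinfun.bounded_linear_right)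
  show "((\<lambda>n. blinfun_apply \<psi> (u n)) \<longlongrightarrow> blinfun_apply \<psi> a) F"
    using *[rule_format, OF bl] by (rule scalar_re_tendstoI)
qed

lemma norm_le_sup_norm: "bounded (range f) \<Longrightarrow> norm (f x) \<le> sup_norm f"
  unfolding sup_norm_def
  by (rule cSUP_upper) (auto simp: bounded_iff bdd_above_def)

lemma sup_norm_bcontfun: "sup_norm (apply_bcontfun f) = norm f"
proof (rule antisym)
  show "sup_norm (apply_bcontfun f) \<le> norm f"
    unfolding sup_norm_def by (rule cSUP_least) (auto simp: norm_bounded)
  show "norm f \<le> sup_norm (apply_bcontfun f)"
    by (rule norm_bound) (simp add: norm_le_sup_norm bounded_apply_bcontfun)
qed

theorem corollary2p5:
  fixes scaleE :: "'k::real_or_complex \<Rightarrow> 'e::banach \<Rightarrow> 'e"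
    and scaleF :: "'k \<Rightarrow> 'f::banach \<Rightarrow> 'f"
    and T :: "('x::t2_space \<Rightarrow>\<^sub>C 'e) \<Rightarrow> ('f \<Rightarrow>\<^sub>L 'k)"
  assumes "compact (UNIV :: 'x set)"
    and "normed_space_over scaleE" and "normed_space_over scaleF"
    and "bounded_linear T"
    and "\<And>c f. T (bcontfun_scale scaleE c f) = dual_scale c (T f)"
    and "range T \<subseteq> dual_space scaleF"
  shows "\<exists>S. weak_sequential_extension scaleE scaleF T S \<and>
             (\<forall>S'. weak_sequential_extension scaleE scaleF T S' \<longrightarrow>
                   (\<forall>f\<in>M_space scaleE. S' f = S f)) \<and>
             continuous_map (M_topology scaleE) euclidean S \<and>
             M_onorm scaleE S = onorm T"
proof -
  interpret E: normed_space_over scaleE by fact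
  interpret F: normed_space_over scaleF by fact
  note X = assms(1) and T_scale = assms(5)
  interpret T: bounded_linear T by fact
  have T_dual: "T f \<in> dual_space scaleF" for f using assms(6) by blast
  note M_eq = E.M_space_eq[where 'x = 'x]
  have M_bounded: "bounded (range f)" if "f \<in> M_space scaleE" for f :: "'x \<Rightarrow> 'e"
    using that by (simp add: M_space_def)
  have T_le: "norm (T f) \<le> onorm T * norm f" for f by (rule onorm[OF assms(4)])
  have T_pos: "0 \<le> onorm T" by (rule onorm_pos_le[OF assms(4)])
  define l where "l y f = scalar_re (blinfun_apply (T f) y)" for y f
  have "\<exists>L. weakly_normal L \<and> (\<forall>f. L (apply_bcontfun f) = l y f) \<and>
    (\<forall>f\<in>real_M_space. \<forall>g\<in>real_M_space. \<forall>b. (\<forall>x. norm (f x - g x) \<le> b) \<longrightarrow>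
       \<bar>L f - L g\<bar> \<le> (onorm T * norm y) * b)" for y
  proof (rule weakly_normal_extension[OF X])
    show "linear (l y)"
      by (rule linearI)
        (simp_all add: l_def T.add T.scale blinfun.add_left blinfun.scaleR_left scalar_re_linear)
    show "0 \<le> onorm T * norm y" using T_pos by simp
    fix f
    have "\<bar>l y f\<bar> \<le> norm (blinfun_apply (T f) y)" unfolding l_def by (rule scalar_re_le)
    also have "\<dots> \<le> norm (T f) * norm y" by (rule norm_blinfun)
    also have "\<dots> \<le> onorm T * norm f * norm y" by (intro mult_right_mono T_le) simp
    finally show "\<bar>l y f\<bar> \<le> onorm T * norm y * norm f" by (simp add: mult_ac)
  qed
  then obtain L where L: "\<And>y. weakly_normal (L y)" "\<And>y f. L y (apply_bcontfun f) = l y f"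
    and L_le: "\<And>y f g b. f \<in> M_space scaleE \<Longrightarrow> g \<in> M_space scaleE \<Longrightarrow> (\<And>x. norm (f x - g x) \<le> b) \<Longrightarrow>
       \<bar>L y f - L y g\<bar> \<le> (onorm T * norm y) * b"
    unfolding M_eq by metis
  have unique: "L1 f = L2 f"
    if "weakly_normal L1" "weakly_normal L2" "\<And>f. L1 (apply_bcontfun f) = L2 (apply_bcontfun f)"
      "f \<in> M_space scaleE" for L1 L2 :: "('x \<Rightarrow> 'e) \<Rightarrow> real" and f
    using weakly_normal_unique[OF X that(1-3)] that(4) unfolding M_eq by blast
  \<comment> \<open>Both sides are weakly normal and restrict to \<open>l (y + z)\<close> on
    continuous functions.\<close>
  have L_add: "L (y + z) f = L y f + L z f" if f: "f \<in> M_space scaleE" for y z f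
    by (rule unique[OF L(1) weakly_normal_plus[OF L(1) L(1)] _ f])
      (simp add: L(2) l_def blinfun.add_right scalar_re_linear)
  have L_scale: "L (r *\<^sub>R y) f = r * L y f" if f: "f \<in> M_space scaleE" for r y f
    by (rule unique[OF L(1) weakly_normal_scale[OF L(1)] _ f])
      (simp add: L(2) l_def blinfun.scaleR_right scalar_re_linear)
  have scaleF_T: "blinfun_apply \<psi> (scaleF c y) = c * blinfun_apply \<psi> y" if "\<psi> \<in> dual_space scaleF" for \<psi> c y
    using that by (simp add: dual_space_def)
  \<comment> \<open>On a continuous \<open>h\<close> both sides are the real part of
    \<open>c * T h y\<close>, by homogeneity of \<open>T h\<close> and of \<open>T\<close>.\<close>
  have L_scalar: "L (scaleF c y) f = L y (\<lambda>x. scaleE c (f x))" if f: "f \<in> M_space scaleE" for c y f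
  proof (rule unique[OF L(1) weakly_normal_compose[OF L(1) E.bounded_linear_scale] _ f])
    fix h :: "'x \<Rightarrow>\<^sub>C 'e"
    have "(\<lambda>x. scaleE c (apply_bcontfun h x)) = apply_bcontfun (bcontfun_scale scaleE c h)"
      by (simp add: fun_eq_iff E.apply_bcontfun_scale)
    then show "L (scaleF c y) (apply_bcontfun h) = L y (\<lambda>x. scaleE c (apply_bcontfun h x))"
      by (simp only: L(2) l_def T_scale scaleF_T[OF T_dual] dual_scale_apply)
  qed
  have zero_M: "(\<lambda>_ :: 'x. 0) \<in> M_space scaleE"
    using bcontfun_in_real_M_space[OF X, of "0 :: 'x \<Rightarrow>\<^sub>C 'e"] by (simp add: M_eq zero_bcontfun.rep_eq)
  have L_norm: "\<bar>L y f\<bar> \<le> (onorm T * sup_norm f) * norm y" if f: "f \<in> M_space scaleE" for y f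
  proof -
    have "L y (\<lambda>_. 0) = 0"
      using weakly_normal_add[OF L(1), of "\<lambda>_. 0" "\<lambda>_. 0" y] zero_M by (simp add: M_eq)
    then show ?thesis
      using L_le[OF f zero_M, of "sup_norm f" y] norm_le_sup_norm[OF M_bounded[OF f]] by (simp add: mult_ac)
  qed
  have sup_norm_nonneg: "0 \<le> sup_norm f" if "bounded (range f)" for f :: "'x \<Rightarrow> 'e"
    using norm_le_sup_norm[OF that, of undefined] norm_ge_zero order_trans by blast
  have ex: "\<exists>\<psi>\<in>dual_space scaleF. (\<forall>y. scalar_re (blinfun_apply \<psi> y) = L y f) \<and> norm \<psi> \<le> onorm T * sup_norm f"
    if f: "f \<in> M_space scaleE" for f
  proof (rule F.dual_space_extension_of_real_part)
    show "linear (\<lambda>y. L y f)" by (rule linearI) (simp_all add: L_add L_scale f)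
    show "0 \<le> onorm T * sup_norm f" using T_pos sup_norm_nonneg[OF M_bounded[OF f]] by simp
  qed (rule L_norm[OF f])
  define S where "S f = (SOME \<psi>. \<psi> \<in> dual_space scaleF \<and> (\<forall>y. scalar_re (blinfun_apply \<psi> y) = L y f) \<and>
      norm \<psi> \<le> onorm T * sup_norm f)" for f
  have S: "S f \<in> dual_space scaleF \<and> (\<forall>y. scalar_re (blinfun_apply (S f) y) = L y f) \<and>
      norm (S f) \<le> onorm T * sup_norm f" if f: "f \<in> M_space scaleE" for f
    unfolding S_def by (rule someI_ex) (use ex[OF f] in blast)
  then have S_dual: "S f \<in> dual_space scaleF" and S_re: "scalar_re (blinfun_apply (S f) y) = L y f"
    and S_norm: "norm (S f) \<le> onorm T * sup_norm f" if "f \<in> M_space scaleE" for f y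
    using that by blast+
  have bcont_M: "apply_bcontfun f \<in> M_space scaleE" for f :: "'x \<Rightarrow>\<^sub>C 'e"
    unfolding M_eq by (rule bcontfun_in_real_M_space[OF X])
  have add_M: "(\<lambda>x. f x + g x) \<in> M_space scaleE" if "f \<in> M_space scaleE" "g \<in> M_space scaleE"
    for f g :: "'x \<Rightarrow> 'e"
    using that unfolding M_eq by (rule real_M_space_add)
  have scale_M: "(\<lambda>x. scaleE c (f x)) \<in> M_space scaleE" if "f \<in> M_space scaleE" for f :: "'x \<Rightarrow> 'e" and c
    using that unfolding M_eq by (rule real_M_space_bounded_linear[OF E.bounded_linear_scale])
  have S_T: "S (apply_bcontfun f) = T f" for f
    by (rule dual_space_eqI[OF S_dual[OF bcont_M] T_dual]) (simp add: S_re[OF bcont_M] L(2) l_def)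
  have S_limit: "limitin (weak_star_topology scaleF) (\<lambda>n. S (u n)) (S f) sequentially"
    if u: "\<And>n. u n \<in> M_space scaleE" and f: "f \<in> M_space scaleE" and B: "\<And>n x. norm (u n x) \<le> B"
      and lim: "\<And>x. limitin (weak_topology scaleE) (\<lambda>n. u n x) (f x) sequentially" for u f B
    unfolding limitin_weak_star_topology[of "\<lambda>n. S (u n)", OF S_dual[OF u]]
  proof (intro conjI allI)
    show "S f \<in> dual_space scaleF" by (rule S_dual[OF f])
    show "(\<lambda>n. blinfun_apply (S (u n)) y) \<longlonglongrightarrow> blinfun_apply (S f) y" for y
    proof (rule scalar_re_tendstoI)
      fix c
      \<comment> \<open>The factor \<open>c\<close> is absorbed into the vector: the real part of
        \<open>c * S (u n) y\<close> is \<open>L (scaleF c y) (u n)\<close>.\<close>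
      have "(\<lambda>n. L (scaleF c y) (u n)) \<longlonglongrightarrow> L (scaleF c y) f"
      proof (rule weakly_normal_tendsto[OF L(1) _ _ B])
        show "u n \<in> real_M_space" for n using u[of n] unfolding M_eq .
        show "f \<in> real_M_space" using f unfolding M_eq .
        show "(\<lambda>n. g (u n x)) \<longlonglongrightarrow> g (f x)" if "bounded_linear g" for g :: "'e \<Rightarrow> real" and x
          by (rule lim[of x, unfolded E.limitin_weak_topology_real, rule_format, OF that])
      qed
      then show "(\<lambda>n. scalar_re (c * blinfun_apply (S (u n)) y)) \<longlonglongrightarrow> scalar_re (c * blinfun_apply (S f) y)"
        by (simp only: scaleF_T[OF S_dual[OF u], symmetric] scaleF_T[OF S_dual[OF f], symmetric] S_re[OF u] S_re[OF f])
    qed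
  qed
  have "M_linear scaleE scaleF S"
    unfolding M_linear_def
  proof (intro conjI ballI allI)
    show "S \<in> M_space scaleE \<rightarrow> dual_space scaleF" using S_dual by blast
    show "S (\<lambda>x. f x + g x) = S f + S g" if f: "f \<in> M_space scaleE" and g: "g \<in> M_space scaleE" for f g
      using weakly_normal_add[OF L(1)] f g
      by (intro dual_space_eqI[OF S_dual[OF add_M[OF f g]] dual_space_add[OF S_dual[OF f] S_dual[OF g]]])
        (simp add: blinfun.add_left scalar_re_linear S_re add_M flip: M_eq)
    show "S (\<lambda>x. scaleE c (f x)) = dual_scale c (S f)" if f: "f \<in> M_space scaleE" for c f
      by (rule dual_space_eqI[OF S_dual[OF scale_M[OF f]] dual_space_scale[OF S_dual[OF f]]])
        (simp add: S_re scale_M f L_scalar[OF f, symmetric] flip: scaleF_T[OF S_dual[OF f]])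
  qed
  then have "weak_sequential_extension scaleE scaleF T S"
    unfolding weak_sequential_extension_def using S_T S_limit by blast
  moreover have "S' f = S f"
    if S': "weak_sequential_extension scaleE scaleF T S'" and f: "f \<in> M_space scaleE" for S' f
  proof -
    have S'_dual: "g \<in> M_space scaleE \<Longrightarrow> S' g \<in> dual_space scaleF"
      and S'_add: "g \<in> M_space scaleE \<Longrightarrow> h \<in> M_space scaleE \<Longrightarrow> S' (\<lambda>x. g x + h x) = S' g + S' h"
      and S'_T: "S' (apply_bcontfun k) = T k" for g h k
      using S' by (auto simp: weak_sequential_extension_def M_linear_def)
    \<comment> \<open>The real part of a competitor at y is a weakly normal extension of
      \<open>l y\<close>, so uniqueness for functionals applies at each y.\<close>
    have S'_normal: "weakly_normal (\<lambda>g. scalar_re (blinfun_apply (S' g) y))" for y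
    proof (rule weakly_normalI)
      show "scalar_re (blinfun_apply (S' (\<lambda>x. g x + h x)) y) =
          scalar_re (blinfun_apply (S' g) y) + scalar_re (blinfun_apply (S' h) y)"
        if "g \<in> real_M_space" "h \<in> real_M_space" for g h
        using S'_add[of g h] that by (simp add: M_eq blinfun.add_left scalar_re_linear)
    next
      fix u :: "nat \<Rightarrow> 'x \<Rightarrow> 'e" and g B
      assume u: "\<And>n. u n \<in> real_M_space" and g: "g \<in> real_M_space" and B: "\<And>n x. norm (u n x) \<le> B"
        and lim: "\<And>\<phi> x. bounded_linear \<phi> \<Longrightarrow> (\<lambda>n. \<phi> (u n x)) \<longlonglongrightarrow> (\<phi> (g x) :: real)"
      have "limitin (weak_topology scaleE) (\<lambda>n. u n x) (g x) sequentially" for x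
        unfolding E.limitin_weak_topology_real using lim by blast
      then have "(\<forall>n. u n \<in> M_space scaleE) \<and> g \<in> M_space scaleE \<and> (\<exists>B. \<forall>n x. norm (u n x) \<le> B) \<and>
          (\<forall>x. limitin (weak_topology scaleE) (\<lambda>n. u n x) (g x) sequentially)"
        using u g B unfolding M_eq by blast
      from S'[unfolded weak_sequential_extension_def, THEN conjunct2, THEN conjunct2, rule_format, OF this]
      have "limitin (weak_star_topology scaleF) (\<lambda>n. S' (u n)) (S' g) sequentially" .
      moreover have "S' (u n) \<in> dual_space scaleF" for n using S'_dual u by (simp add: M_eq)
      ultimately have "(\<lambda>n. blinfun_apply (S' (u n)) y) \<longlonglongrightarrow> blinfun_apply (S' g) y"
        by (simp add: limitin_weak_star_topology)
      then show "(\<lambda>n. scalar_re (blinfun_apply (S' (u n)) y)) \<longlonglongrightarrow> scalar_re (blinfun_apply (S' g) y)"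
        by (rule bounded_linear.tendsto[OF bounded_linear_scalar_re])
    qed
    show ?thesis
    proof (rule dual_space_eqI[OF S'_dual[OF f] S_dual[OF f]])
      show "scalar_re (blinfun_apply (S' f) y) = scalar_re (blinfun_apply (S f) y)" for y
        unfolding S_re[OF f] by (rule unique[OF S'_normal L(1) _ f]) (simp add: S'_T L(2) l_def)
    qed
  qed
  moreover have "continuous_map (M_topology scaleE) euclidean S"
  proof -
    interpret M: Metric_space "M_space scaleE :: ('x \<Rightarrow> 'e) set" "Met_TC.fdist UNIV"
      by (rule Metric_space_M_space)
    have S_lipschitz: "norm (S f - S g) \<le> onorm T * Met_TC.fdist UNIV f g"
      if f: "f \<in> M_space scaleE" and g: "g \<in> M_space scaleE" for f g
    proof -
      have bdd: "bounded (range (\<lambda>x. f x - g x))"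
        by (intro bounded_minus_comp M_bounded f g)
      have "norm (S f - S g) \<le> onorm T * sup_norm (\<lambda>x. f x - g x)"
      proof (rule F.norm_dual_space_le[OF dual_space_diff[OF S_dual[OF f] S_dual[OF g]]])
        show "0 \<le> onorm T * sup_norm (\<lambda>x. f x - g x)" using T_pos sup_norm_nonneg[OF bdd] by simp
        show "\<bar>scalar_re (blinfun_apply (S f - S g) y)\<bar> \<le> onorm T * sup_norm (\<lambda>x. f x - g x) * norm y" for y
          using L_le[OF f g norm_le_sup_norm[OF bdd], of y]
          by (simp add: blinfun.diff_left scalar_re_linear S_re f g mult_ac)
      qed
      then show ?thesis by (simp add: fdist_eq_sup_norm[OF f g])
    qed
    show ?thesis
      unfolding continuous_map_def M_topology_def
    proof (intro conjI allI impI)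
      fix U :: "('f \<Rightarrow>\<^sub>L 'k) set" assume "openin euclidean U"
      then have U: "open U" by simp
      show "openin M.mtopology {f \<in> topspace M.mtopology. S f \<in> U}"
        unfolding M.openin_mtopology
      proof (intro conjI allI impI)
        fix f assume "f \<in> {f \<in> topspace M.mtopology. S f \<in> U}"
        then have f: "f \<in> M_space scaleE" "S f \<in> U" by auto
        then obtain e where e: "0 < e" "ball (S f) e \<subseteq> U" using U by (meson openE)
        \<comment> \<open>Adding 1 avoids division by 0 when \<open>T = 0\<close>.\<close>
        define r where "r = e / (onorm T + 1)"
        have r: "0 < r" "onorm T * r < e" using e(1) T_pos by (auto simp: r_def field_simps)
        have "S g \<in> U" if g: "g \<in> M.mball f r" for g
        proof -
          have gM: "g \<in> M_space scaleE" and fg: "Met_TC.fdist UNIV f g < r" using g by auto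
          have "norm (S f - S g) \<le> onorm T * r"
            using S_lipschitz[OF f(1) gM] mult_left_mono[OF less_imp_le[OF fg] T_pos] by simp
          then show ?thesis using r(2) e(2) by (auto simp: dist_norm)
        qed
        then show "\<exists>r>0. M.mball f r \<subseteq> {f \<in> topspace M.mtopology. S f \<in> U}"
          using r(1) by (auto intro!: exI[of _ r])
      qed auto
    qed auto
  qed
  moreover have "M_onorm scaleE S = onorm T"
  proof (rule antisym)
    \<comment> \<open>When the sup-norm is 0 the quotient is 0 by convention, so the zero function
      does not disturb the supremum.\<close>
    have le: "norm (S f) / sup_norm f \<le> onorm T" if f: "f \<in> M_space scaleE" for f
    proof (cases "sup_norm f = 0")
      case False
      then have "0 < sup_norm f" using sup_norm_nonneg[OF M_bounded[OF f]] by simp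
      then show ?thesis using S_norm[OF f] by (simp add: divide_le_eq)
    qed (simp add: T_pos)
    then show "M_onorm scaleE S \<le> onorm T"
      unfolding M_onorm_def using zero_M by (intro cSUP_least) auto
    show "onorm T \<le> M_onorm scaleE S"
    proof (rule onorm_bound)
      have upper: "norm (S f) / sup_norm f \<le> M_onorm scaleE S" if "f \<in> M_space scaleE" for f
        unfolding M_onorm_def
        by (rule cSUP_upper[OF that]) (use le in \<open>auto simp: bdd_above_def\<close>)
      \<comment> \<open>The quotient at the zero function is 0, which makes the supremum nonnegative
        even if E is trivial.\<close>
      have "0 \<le> norm (S (\<lambda>_. 0)) / sup_norm (\<lambda>_ :: 'x. 0 :: 'e)"
        by (simp add: sup_norm_def)
      also have "\<dots> \<le> M_onorm scaleE S" by (rule upper[OF zero_M])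
      finally show "0 \<le> M_onorm scaleE S" .
      fix f :: "'x \<Rightarrow>\<^sub>C 'e"
      show "norm (T f) \<le> M_onorm scaleE S * norm f"
        using upper[OF bcont_M, of f]
        by (cases "f = 0") (simp_all add: S_T sup_norm_bcontfun divide_le_eq T.zero)
    qed
  qed
  ultimately show ?thesis by blast
qed

end
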